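(* Under the structure semantics, the satisfiability problem is undecidable for $\mathsf{AQ}^k\mathsf{CTL}$ for every $k\ge1$, and for $\mathsf{EQ}^k\mathsf{CTL}$ for every $k\ge2$.
   Context: Fix a set $AP$ of atomic propositions. A Kripke structure is $S=(Q,R,\ell)$ with $Q$ countable, $R\subseteq Q\times Q$ total, $\ell:Q\to2^{AP}$. $\mathsf{CTL}$: $\varphi::=p\mid\neg\varphi\mid\varphi\vee\varphi\mid\mathbf{E}\varphi\mathbf{U}\varphi\mid\mathbf{A}\varphi\mathbf{U}\varphi\mid\mathbf{EX}\varphi\mid\mathbf{AX}\varphi$ with standard semantics; quantification $\exists p.\varphi$ (and $\forall p=\neg\exists p\neg$) has structure semantics $S,q\models_s\exists p.\varphi$ iff some $S'=(Q,R,\ell')$ with $\ell'$ agreeing with $\ell$ on $AP\setminus\{p\}$ satisfies $S',q\models_s\varphi$. For $\varphi\in\mathsf{CTL}$, $\exists p.\varphi\in\mathsf{EQ}^1\mathsf{CTL}$ and $\forall p.\varphi\in\mathsf{AQ}^1\mathsf{CTL}$; if $\varphi\in\mathsf{EQ}^k\mathsf{CTL}$ then $\exists p.\varphi\in\mathsf{EQ}^k\mathsf{CTL}$ and $\forall p.\varphi\in\mathsf{AQ}^{k+1}\mathsf{CTL}$; if $\varphi\in\mathsf{AQ}^k\mathsf{CTL}$ then $\exists p.\varphi\in\mathsf{EQ}^{k+1}\mathsf{CTL}$ and $\forall p.\varphi\in\mathsf{AQ}^k\mathsf{CTL}$. Satisfiability problem: given $\varphi$, decide whether there exist a finite Kripke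 structure $S$ and a state $q$ with $S,q\models_s\varphi$. *)

theory Defs
  imports Main "HOL-Library.Nat_Bijection" "HOL-Library.Countable_Set"
begin

section \<open>Syntax of quantified CTL\<close>

text \<open>Atomic propositions are the natural numbers: a countably infinite set AP, with
  elements that can be handed to an algorithm.\<close>

type_synonym ap = nat

datatype qctl =
    Prop ap
  | Neg qctl
  | Or qctl qctl
  | EUntil qctl qctl
  | AUntil qctl qctl
  | ENext qctl
  | ANext qctl
  | Exists ap qctl

abbreviation Forall :: "ap \<Rightarrow> qctl \<Rightarrow> qctl" where
  "Forall p \<phi> \<equiv> Neg (Exists p (Neg \<phi>))"

inductive CTL :: "qctl \<Rightarrow> bool" where
  "CTL (Prop p)"
| "CTL \<phi> \<Longrightarrow> CTL (Neg \<phi>)"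
| "CTL \<phi> \<Longrightarrow> CTL \<psi> \<Longrightarrow> CTL (Or \<phi> \<psi>)"
| "CTL \<phi> \<Longrightarrow> CTL \<psi> \<Longrightarrow> CTL (EUntil \<phi> \<psi>)"
| "CTL \<phi> \<Longrightarrow> CTL \<psi> \<Longrightarrow> CTL (AUntil \<phi> \<psi>)"
| "CTL \<phi> \<Longrightarrow> CTL (ENext \<phi>)"
| "CTL \<phi> \<Longrightarrow> CTL (ANext \<phi>)"

inductive EQCTL :: "nat \<Rightarrow> qctl \<Rightarrow> bool" and AQCTL :: "nat \<Rightarrow> qctl \<Rightarrow> bool" where
  "CTL \<phi> \<Longrightarrow> EQCTL 1 (Exists p \<phi>)"
| "CTL \<phi> \<Longrightarrow> AQCTL 1 (Forall p \<phi>)"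
| "EQCTL k \<phi> \<Longrightarrow> EQCTL k (Exists p \<phi>)"
| "EQCTL k \<phi> \<Longrightarrow> AQCTL (k + 1) (Forall p \<phi>)"
| "AQCTL k \<phi> \<Longrightarrow> EQCTL (k + 1) (Exists p \<phi>)"
| "AQCTL k \<phi> \<Longrightarrow> AQCTL k (Forall p \<phi>)"


section \<open>Kripke structures and the structure semantics\<close>

text \<open>Only the values of \<open>label\<close> on \<open>states\<close> matter.\<close>

record 's kripke =
  states :: "'s set"
  transitions :: "('s \<times> 's) set"
  label :: "'s \<Rightarrow> ap set"

definition kripke_structure :: "'s kripke \<Rightarrow> bool" where
  "kripke_structure S \<longleftrightarrow>
     countable (states S) \<and> transitions S \<subseteq> states S \<times> states S \<and>
     (\<forall>q\<in>states S. \<exists>q'\<in>states S. (q, q') \<in> transitions S)"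

definition path_from :: "'s kripke \<Rightarrow> 's \<Rightarrow> (nat \<Rightarrow> 's) \<Rightarrow> bool" where
  "path_from S q \<rho> \<longleftrightarrow> \<rho> 0 = q \<and> (\<forall>i. (\<rho> i, \<rho> (Suc i)) \<in> transitions S)"

definition agree_except :: "'s kripke \<Rightarrow> ap \<Rightarrow> ('s \<Rightarrow> ap set) \<Rightarrow> bool" where
  "agree_except S p l' \<longleftrightarrow> (\<forall>s\<in>states S. l' s \<inter> (UNIV - {p}) = label S s \<inter> (UNIV - {p}))"

primrec sat :: "'s kripke \<Rightarrow> 's \<Rightarrow> qctl \<Rightarrow> bool" where
  "sat S q (Prop p) \<longleftrightarrow> p \<in> label S q"
| "sat S q (Neg \<phi>) \<longleftrightarrow> \<not> sat S q \<phi>"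
| "sat S q (Or \<phi> \<psi>) \<longleftrightarrow> sat S q \<phi> \<or> sat S q \<psi>"
| "sat S q (EUntil \<phi> \<psi>) \<longleftrightarrow>
     (\<exists>\<rho>. path_from S q \<rho> \<and> (\<exists>i. sat S (\<rho> i) \<psi> \<and> (\<forall>j<i. sat S (\<rho> j) \<phi>)))"
| "sat S q (AUntil \<phi> \<psi>) \<longleftrightarrow>
     (\<forall>\<rho>. path_from S q \<rho> \<longrightarrow> (\<exists>i. sat S (\<rho> i) \<psi> \<and> (\<forall>j<i. sat S (\<rho> j) \<phi>)))"
| "sat S q (ENext \<phi>) \<longleftrightarrow> (\<exists>q'. (q, q') \<in> transitions S \<and> sat S q' \<phi>)"
| "sat S q (ANext \<phi>) \<longleftrightarrow> (\<forall>q'. (q, q') \<in> transitions S \<longrightarrow> sat S q' \<phi>)"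
| "sat S q (Exists p \<phi>) \<longleftrightarrow> (\<exists>l'. agree_except S p l' \<and> sat (S\<lparr>label := l'\<rparr>) q \<phi>)"

text \<open>States are natural numbers here because a type cannot be quantified inside a formula;
  this loses nothing, see \<open>finitely_satisfiableI\<close> below.\<close>

definition finitely_satisfiable :: "qctl \<Rightarrow> bool" where
  "finitely_satisfiable \<phi> \<longleftrightarrow>
     (\<exists>(S :: nat kripke) q. kripke_structure S \<and> finite (states S) \<and> q \<in> states S \<and> sat S q \<phi>)"

lemma path_from_states:
  assumes "kripke_structure S" "path_from S q \<rho>"
  shows "\<rho> i \<in> states S"
  using assms unfolding kripke_structure_def path_from_def by blast

lemma path_from_iso:
  assumes S: "kripke_structure S" and f: "inj_on f (states S)" and q: "q \<in> states S"
    and T: "transitions T = map_prod f f ` transitions S"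
  shows "path_from T (f q) \<sigma> \<longleftrightarrow> (\<exists>\<rho>. path_from S q \<rho> \<and> \<sigma> = f \<circ> \<rho>)"
proof
  assume \<sigma>: "path_from T (f q) \<sigma>"
  define \<rho> where "\<rho> = inv_into (states S) f \<circ> \<sigma>"
  have sub: "transitions S \<subseteq> states S \<times> states S" using S by (simp add: kripke_structure_def)
  have step: "(\<rho> i, \<rho> (Suc i)) \<in> transitions S \<and> \<sigma> i = f (\<rho> i)" for i
  proof -
    have "(\<sigma> i, \<sigma> (Suc i)) \<in> map_prod f f ` transitions S"
      using \<sigma> T by (simp add: path_from_def)
    then obtain x y where xy: "(x, y) \<in> transitions S" "\<sigma> i = f x" "\<sigma> (Suc i) = f y" by auto
    with sub have "x \<in> states S" "y \<in> states S" by auto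
    with xy f show ?thesis by (simp add: \<rho>_def)
  qed
  have "\<rho> 0 = q" using \<sigma> f q by (simp add: \<rho>_def path_from_def)
  with step show "\<exists>\<rho>. path_from S q \<rho> \<and> \<sigma> = f \<circ> \<rho>"
    by (intro exI[of _ \<rho>]) (auto simp: path_from_def)
next
  assume "\<exists>\<rho>. path_from S q \<rho> \<and> \<sigma> = f \<circ> \<rho>"
  then show "path_from T (f q) \<sigma>"
    by (auto simp: path_from_def T intro: rev_image_eqI)
qed

lemma trans_iso:
  assumes S: "kripke_structure S" and f: "inj_on f (states S)" and q: "q \<in> states S"
    and T: "transitions T = map_prod f f ` transitions S"
  shows "(f q, t) \<in> transitions T \<longleftrightarrow> (\<exists>q'. (q, q') \<in> transitions S \<and> t = f q')"
proof
  assume "(f q, t) \<in> transitions T"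
  then obtain x y where xy: "(x, y) \<in> transitions S" "f q = f x" "t = f y"
    by (auto simp: T)
  moreover have "x \<in> states S" using S xy(1) by (auto simp: kripke_structure_def)
  ultimately have "x = q" using f q by (metis inj_onD)
  with xy show "\<exists>q'. (q, q') \<in> transitions S \<and> t = f q'" by blast
qed (auto simp: T)

lemma sat_iso:
  assumes "kripke_structure S" "inj_on f (states S)" "q \<in> states S"
    and "states T = f ` states S" "transitions T = map_prod f f ` transitions S"
    and "\<forall>s\<in>states S. label T (f s) = label S s"
  shows "sat T (f q) \<phi> \<longleftrightarrow> sat S q \<phi>"
  using assms
proof (induction \<phi> arbitrary: S T q)
  case (EUntil \<phi> \<psi>)
  define X where "X \<sigma> \<longleftrightarrow> (\<exists>i. sat T (\<sigma> i) \<psi> \<and> (\<forall>j<i. sat T (\<sigma> j) \<phi>))"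
    for \<sigma> :: "nat \<Rightarrow> _"
  define Y where "Y \<rho> \<longleftrightarrow> (\<exists>i. sat S (\<rho> i) \<psi> \<and> (\<forall>j<i. sat S (\<rho> j) \<phi>))"
    for \<rho> :: "nat \<Rightarrow> _"
  have "X (f \<circ> \<rho>) \<longleftrightarrow> Y \<rho>" if "path_from S q \<rho>" for \<rho>
  proof -
    have st: "\<rho> i \<in> states S" for i
      using path_from_states[OF EUntil.prems(1) that] .
    have "sat T (f (\<rho> i)) \<phi> = sat S (\<rho> i) \<phi>" "sat T (f (\<rho> i)) \<psi> = sat S (\<rho> i) \<psi>" for i
      by (rule EUntil.IH; rule EUntil.prems st)+
    then show ?thesis by (simp add: X_def Y_def)
  qed
  moreover have "sat T (f q) (EUntil \<phi> \<psi>) \<longleftrightarrow> (\<exists>\<sigma>. path_from T (f q) \<sigma> \<and> X \<sigma>)"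
    and "sat S q (EUntil \<phi> \<psi>) \<longleftrightarrow> (\<exists>\<rho>. path_from S q \<rho> \<and> Y \<rho>)"
    by (simp_all add: X_def Y_def)
  ultimately show ?case
    using path_from_iso[OF EUntil.prems(1-3,5)] by auto
next
  case (AUntil \<phi> \<psi>)
  define X where "X \<sigma> \<longleftrightarrow> (\<exists>i. sat T (\<sigma> i) \<psi> \<and> (\<forall>j<i. sat T (\<sigma> j) \<phi>))"
    for \<sigma> :: "nat \<Rightarrow> _"
  define Y where "Y \<rho> \<longleftrightarrow> (\<exists>i. sat S (\<rho> i) \<psi> \<and> (\<forall>j<i. sat S (\<rho> j) \<phi>))"
    for \<rho> :: "nat \<Rightarrow> _"
  have "X (f \<circ> \<rho>) \<longleftrightarrow> Y \<rho>" if "path_from S q \<rho>" for \<rho>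
  proof -
    have st: "\<rho> i \<in> states S" for i
      using path_from_states[OF AUntil.prems(1) that] .
    have "sat T (f (\<rho> i)) \<phi> = sat S (\<rho> i) \<phi>" "sat T (f (\<rho> i)) \<psi> = sat S (\<rho> i) \<psi>" for i
      by (rule AUntil.IH; rule AUntil.prems st)+
    then show ?thesis by (simp add: X_def Y_def)
  qed
  moreover have "sat T (f q) (AUntil \<phi> \<psi>) \<longleftrightarrow> (\<forall>\<sigma>. path_from T (f q) \<sigma> \<longrightarrow> X \<sigma>)"
    and "sat S q (AUntil \<phi> \<psi>) \<longleftrightarrow> (\<forall>\<rho>. path_from S q \<rho> \<longrightarrow> Y \<rho>)"
    by (simp_all add: X_def Y_def)
  ultimately show ?case
    using path_from_iso[OF AUntil.prems(1-3,5)] by auto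
next
  case (ENext \<phi>)
  have "sat T (f q') \<phi> = sat S q' \<phi>" if "(q, q') \<in> transitions S" for q'
  proof -
    have "q' \<in> states S" using ENext.prems(1) that by (auto simp: kripke_structure_def)
    then show ?thesis by (intro ENext.IH[OF ENext.prems(1,2) _ ENext.prems(4-6)])
  qed
  then show ?case by (auto simp: trans_iso[OF ENext.prems(1-3,5)])
next
  case (ANext \<phi>)
  have "sat T (f q') \<phi> = sat S q' \<phi>" if "(q, q') \<in> transitions S" for q'
  proof -
    have "q' \<in> states S" using ANext.prems(1) that by (auto simp: kripke_structure_def)
    then show ?thesis by (intro ANext.IH[OF ANext.prems(1,2) _ ANext.prems(4-6)])
  qed
  then show ?case by (auto simp: trans_iso[OF ANext.prems(1-3,5)])
next
  case (Exists p \<phi>)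
  have upd: "sat (T\<lparr>label := k\<rparr>) (f q) \<phi> = sat (S\<lparr>label := l\<rparr>) q \<phi>"
    if "\<forall>s\<in>states S. k (f s) = l s" for k l
    using Exists.prems that
    by (intro Exists.IH) (auto simp: kripke_structure_def)
  show ?case
  proof
    assume "sat T (f q) (Exists p \<phi>)"
    then obtain k where "agree_except T p k" "sat (T\<lparr>label := k\<rparr>) (f q) \<phi>" by auto
    then have "agree_except S p (k \<circ> f)" "sat (S\<lparr>label := k \<circ> f\<rparr>) q \<phi>"
      using Exists.prems upd[of k "k \<circ> f"] by (auto simp: agree_except_def)
    then show "sat S q (Exists p \<phi>)" by auto
  next
    assume "sat S q (Exists p \<phi>)"
    then obtain l where l: "agree_except S p l" "sat (S\<lparr>label := l\<rparr>) q \<phi>" by auto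
    let ?k = "l \<circ> inv_into (states S) f"
    have k: "\<forall>s\<in>states S. ?k (f s) = l s" using Exists.prems by simp
    have "agree_except T p ?k"
      using Exists.prems l(1) by (simp add: agree_except_def)
    moreover have "sat (T\<lparr>label := ?k\<rparr>) (f q) \<phi>"
      using upd[OF k] l(2) by blast
    ultimately show "sat T (f q) (Exists p \<phi>)" unfolding sat.simps by blast
  qed
qed auto

lemma finitely_satisfiableI:
  fixes S :: "'s kripke"
  assumes S: "kripke_structure S" and fin: "finite (states S)" and q: "q \<in> states S"
    and sat: "sat S q \<phi>"
  shows "finitely_satisfiable \<phi>"
proof -
  obtain f :: "'s \<Rightarrow> nat" where f: "inj_on f (states S)"
    using countableE[OF countable_finite[OF fin]] .
  define T where "T = \<lparr>states = f ` states S, transitions = map_prod f f ` transitions S,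
    label = (\<lambda>n. label S (inv_into (states S) f n))\<rparr>"
  have T: "states T = f ` states S" "transitions T = map_prod f f ` transitions S"
    "\<forall>s\<in>states S. label T (f s) = label S s"
    using f by (simp_all add: T_def)
  have "sat T (f q) \<phi>"
    using sat_iso[OF S f q T] sat by blast
  moreover have "kripke_structure T"
    unfolding kripke_structure_def
  proof (intro conjI ballI)
    show "countable (states T)" using T(1) fin by (simp add: countable_finite)
    show "transitions T \<subseteq> states T \<times> states T"
      unfolding T using S by (auto simp: kripke_structure_def)
    fix t assume "t \<in> states T"
    then obtain s where s: "s \<in> states S" "t = f s" using T(1) by auto
    with S obtain s' where s': "s' \<in> states S" "(s, s') \<in> transitions S"
      by (auto simp: kripke_structure_def)
    then have "(f s, f s') \<in> transitions T" unfolding T by (auto intro: rev_image_eqI)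
    with s s' show "\<exists>t'\<in>states T. (t, t') \<in> transitions T" unfolding T(1) by blast
  qed
  moreover have "finite (states T)" "f q \<in> states T" using fin q T(1) by simp_all
  ultimately show ?thesis
    unfolding finitely_satisfiable_def by blast
qed


section \<open>Decidability\<close>

text \<open>Partial recursive functions. \<open>rec_eval f xs y\<close> means that the function denoted by \<open>f\<close> is
  defined on the arguments \<open>xs\<close>, with value \<open>y\<close>. Arities are not tracked: \<open>Zero\<close> accepts any
  argument list, \<open>Proj i\<close> any list with more than \<open>i\<close> elements, and a term is undefined on lists
  that it does not accept.\<close>

datatype recf =
    Zero
  | Succ
  | Proj nat
  | Comp recf "recf list"
  | PrimRec recf recf
  | Mu recf

inductive rec_eval :: "recf \<Rightarrow> nat list \<Rightarrow> nat \<Rightarrow> bool" where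
  zero: "rec_eval Zero xs 0"
| succ: "rec_eval Succ [x] (Suc x)"
| proj: "i < length xs \<Longrightarrow> rec_eval (Proj i) xs (xs ! i)"
| comp: "list_all2 (\<lambda>g y. rec_eval g xs y) gs ys \<Longrightarrow> rec_eval f ys z \<Longrightarrow>
    rec_eval (Comp f gs) xs z"
| primrec_0: "rec_eval f xs y \<Longrightarrow> rec_eval (PrimRec f g) (0 # xs) y"
| primrec_Suc: "rec_eval (PrimRec f g) (n # xs) y \<Longrightarrow> rec_eval g (n # y # xs) z \<Longrightarrow>
    rec_eval (PrimRec f g) (Suc n # xs) z"
| mu: "rec_eval f (n # xs) 0 \<Longrightarrow> \<forall>m<n. \<exists>y. y > 0 \<and> rec_eval f (m # xs) y \<Longrightarrow>
    rec_eval (Mu f) xs n"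

lemma rec_eval_deterministic: "rec_eval f xs y \<Longrightarrow> rec_eval f xs z \<Longrightarrow> y = z"
proof (induction arbitrary: z rule: rec_eval.induct)
  case (zero xs)
  then show ?case by cases auto
next
  case (succ x)
  then show ?case by cases auto
next
  case (proj i xs)
  from proj(2) show ?case by cases auto
next
  case (comp xs gs ys f y)
  from comp.prems obtain ys' where *: "list_all2 (\<lambda>g y. rec_eval g xs y) gs ys'" "rec_eval f ys' z"
    by cases auto
  have "ys = ys'"
    using comp.IH(1) *(1) by (intro nth_equalityI) (auto simp: list_all2_conv_all_nth)
  with comp.IH(2) * show ?case by blast
next
  case (primrec_0 f xs y g)
  from primrec_0.prems have "rec_eval f xs z" by cases auto
  then show ?case by (rule primrec_0.IH)
next
  case (primrec_Suc f g n xs y w)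
  from primrec_Suc.prems obtain y' where
    "rec_eval (PrimRec f g) (n # xs) y'" "rec_eval g (n # y' # xs) z"
    by cases auto
  with primrec_Suc.IH show ?case by blast
next
  case (mu f n xs)
  from mu.prems have z: "rec_eval f (z # xs) 0" "\<forall>m<z. \<exists>y. y > 0 \<and> rec_eval f (m # xs) y"
    by (cases, blast)+
  have "\<not> z < n"
  proof
    assume "z < n"
    with mu.IH(2) obtain y where "y > 0" "\<forall>w. rec_eval f (z # xs) w \<longrightarrow> y = w" by blast
    with z(1) show False by auto
  qed
  moreover have "\<not> n < z"
  proof
    assume "n < z"
    with z(2) obtain y where "y > 0" "rec_eval f (n # xs) y" by blast
    with mu.IH(1) show False by fastforce
  qed
  ultimately show ?case by simp
qed

text \<open>The problem ``given an element \<open>x\<close> of \<open>I\<close>, does \<open>P x\<close> hold?'', where \<open>x\<close> is presented to the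
  algorithm as \<open>code x\<close>. The algorithm has to halt, with the correct answer, on the codes of
  elements of \<open>I\<close> only.\<close>

definition decidable_problem :: "('a \<Rightarrow> nat) \<Rightarrow> 'a set \<Rightarrow> ('a \<Rightarrow> bool) \<Rightarrow> bool" where
  "decidable_problem code I P \<longleftrightarrow>
     (\<exists>f. \<forall>x\<in>I. rec_eval f [code x] (if P x then 1 else 0))"

primrec qctl_code :: "qctl \<Rightarrow> nat" where
  "qctl_code (Prop p) = prod_encode (0, p)"
| "qctl_code (Neg \<phi>) = prod_encode (1, qctl_code \<phi>)"
| "qctl_code (Or \<phi> \<psi>) = prod_encode (2, prod_encode (qctl_code \<phi>, qctl_code \<psi>))"
| "qctl_code (EUntil \<phi> \<psi>) = prod_encode (3, prod_encode (qctl_code \<phi>, qctl_code \<psi>))"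
| "qctl_code (AUntil \<phi> \<psi>) = prod_encode (4, prod_encode (qctl_code \<phi>, qctl_code \<psi>))"
| "qctl_code (ENext \<phi>) = prod_encode (5, qctl_code \<phi>)"
| "qctl_code (ANext \<phi>) = prod_encode (6, qctl_code \<phi>)"
| "qctl_code (Exists p \<phi>) = prod_encode (7, prod_encode (p, qctl_code \<phi>))"

lemma inj_qctl_code: "inj qctl_code"
proof (rule injI)
  show "\<phi> = \<psi>" if "qctl_code \<phi> = qctl_code \<psi>" for \<phi> \<psi>
    using that
  proof (induction \<phi> arbitrary: \<psi>)
    case (Prop p) then show ?case by (cases \<psi>) (auto simp: prod_encode_eq)
  next
    case (Neg \<phi>) then show ?case by (cases \<psi>) (auto simp: prod_encode_eq)
  next
    case (Or \<phi> \<phi>') then show ?case by (cases \<psi>) (auto simp: prod_encode_eq)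
  next
    case (EUntil \<phi> \<phi>') then show ?case by (cases \<psi>) (auto simp: prod_encode_eq)
  next
    case (AUntil \<phi> \<phi>') then show ?case by (cases \<psi>) (auto simp: prod_encode_eq)
  next
    case (ENext \<phi>) then show ?case by (cases \<psi>) (auto simp: prod_encode_eq)
  next
    case (ANext \<phi>) then show ?case by (cases \<psi>) (auto simp: prod_encode_eq)
  next
    case (Exists p \<phi>) then show ?case by (cases \<psi>) (auto simp: prod_encode_eq)
  qed
qed

end

theory Submission imports Defs begin

text \<open>A halting computation of a recursive function \<open>f\<close> is a finite derivation tree of
  \<^const>\<open>rec_eval\<close>. In a Kripke structure that represents such a tree, a universally quantified
  proposition \<open>p\<close> can express that two paths lead to the same node: if the target of the first is
  in \<open>p\<close>, then so is the target of the second. CTL can therefore check every inference locally, and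
  an \<open>AF\<close> formula excludes circular derivations. Hence for every \<open>f\<close> there is a CTL formula that,
  together with a description of the input \<open>n\<close>, is satisfiable under \<open>\<forall>p\<close> iff \<open>f\<close> halts on \<open>n\<close>.
  Diagonalization needs neither a universal machine nor an encoding of programs, because the code
  of this formula can serve as the program.\<close>

section \<open>Computable functions\<close>

text \<open>Decidability is defined through \<open>rec_eval\<close>, so taking its own derivations
  as the computations to be described avoids any simulation between machine models. Every derivation
  extracted from the states reachable from the root is sound, so sharing of nodes and additional
  states in a model do no harm.

  The formula describing a function does not mention the input; the input is described separately,
  by iterating one operator \<open>n\<close> times. A program can therefore pair a number
  \<open>n\<close>, meant as the code of a formula, with the computable code of the description of
  input \<open>n\<close>, and never has to decode anything.

  The classes \<open>AQCTL k\<close> and \<open>EQCTL k\<close> count alternations exactly. Hardness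
  for one universal quantifier thus has to be transported to each level by prefixes without effect;
  a leading existential quantifier costs nothing, because satisfiability already chooses the
  labelling.\<close>

definition computable :: "(nat \<Rightarrow> nat) \<Rightarrow> bool" where
  "computable F \<longleftrightarrow> (\<exists>f. \<forall>x. rec_eval f [x] (F x))"

definition computable2 :: "(nat \<Rightarrow> nat \<Rightarrow> nat) \<Rightarrow> bool" where
  "computable2 F \<longleftrightarrow> (\<exists>f. \<forall>x y. rec_eval f [x, y] (F x y))"

lemma rec_eval_const: "\<exists>f. \<forall>xs. rec_eval f xs n"
proof (induction n)
  case 0
  then show ?case using rec_eval.zero by blast
next
  case (Suc n)
  then obtain f where "\<forall>xs. rec_eval f xs n" ..
  then have "\<forall>xs. rec_eval (Comp Succ [f]) xs (Suc n)"
    by (auto intro!: rec_eval.comp[where ys = "[n]"] rec_eval.succ)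
  then show ?case ..
qed

lemma rec_eval_Comp1:
  "rec_eval g xs y \<Longrightarrow> rec_eval f [y] z \<Longrightarrow> rec_eval (Comp f [g]) xs z"
  by (rule rec_eval.comp[where ys = "[y]"]) auto

lemma rec_eval_Comp2:
  "rec_eval g xs y \<Longrightarrow> rec_eval h xs y' \<Longrightarrow> rec_eval f [y, y'] z \<Longrightarrow>
    rec_eval (Comp f [g, h]) xs z"
  by (rule rec_eval.comp[where ys = "[y, y']"]) auto

lemma rec_eval_Proj0: "rec_eval (Proj 0) (x # xs) x"
  using rec_eval.proj[of 0 "x # xs"] by simp

lemma rec_eval_Proj1: "rec_eval (Proj 1) (x # y # xs) y"
  using rec_eval.proj[of 1 "x # y # xs"] by simp

lemma computable_const: "computable (\<lambda>_. n)"
  using rec_eval_const unfolding computable_def by blast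

lemma computable_id: "computable (\<lambda>x. x)"
  unfolding computable_def using rec_eval_Proj0 by blast

lemma computable_compose:
  assumes "computable F" "computable G"
  shows "computable (\<lambda>x. F (G x))"
  using assms unfolding computable_def by (metis rec_eval_Comp1)

lemma computable2_compose:
  assumes "computable2 F" "computable G" "computable H"
  shows "computable (\<lambda>x. F (G x) (H x))"
proof -
  obtain f g h where "\<forall>x y. rec_eval f [x, y] (F x y)" "\<forall>x. rec_eval g [x] (G x)"
    "\<forall>x. rec_eval h [x] (H x)"
    using assms unfolding computable_def computable2_def by blast
  then have "\<forall>x. rec_eval (Comp f [g, h]) [x] (F (G x) (H x))"
    using rec_eval_Comp2 by blast
  then show ?thesis unfolding computable_def ..
qed

lemma computable2_add: "computable2 (+)"
proof -
  have "rec_eval (PrimRec (Proj 0) (Comp Succ [Proj 1])) [x, y] (x + y)" for x y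
  proof (induction x)
    case 0
    show ?case unfolding add_0 by (rule rec_eval.primrec_0 rec_eval_Proj0)+
  next
    case (Suc x)
    show ?case
      unfolding add_Suc
      by (rule rec_eval.primrec_Suc[OF Suc] rec_eval_Comp1 rec_eval_Proj1 rec_eval.succ)+
  qed
  then show ?thesis unfolding computable2_def by blast
qed

lemma computable_funpow:
  assumes "computable F"
  shows "computable (\<lambda>n. (F ^^ n) a)"
proof -
  obtain f where f: "\<forall>x. rec_eval f [x] (F x)" using assms computable_def by blast
  obtain g where g: "\<forall>xs. rec_eval g xs a" using rec_eval_const by blast
  have "rec_eval (PrimRec g (Comp f [Proj 1])) [n] ((F ^^ n) a)" for n
  proof (induction n)
    case 0
    then show ?case using g by (auto intro: rec_eval.primrec_0)
  next
    case (Suc n)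
    show ?case
      unfolding funpow.simps comp_def
      by (rule rec_eval.primrec_Suc[OF Suc] rec_eval_Comp1 rec_eval_Proj1 f[rule_format])+
  qed
  then show ?thesis unfolding computable_def by blast
qed

lemma computable_triangle: "computable triangle"
proof -
  obtain add where add: "\<forall>x y. rec_eval add [x, y] (x + y)"
    using computable2_add computable2_def by blast
  have "rec_eval (PrimRec Zero (Comp add [Proj 1, Comp Succ [Proj 0]])) [n] (triangle n)" for n
  proof (induction n)
    case 0
    then show ?case by (auto intro: rec_eval.primrec_0 rec_eval.zero)
  next
    case (Suc n)
    show ?case
      unfolding triangle_Suc
      by (rule rec_eval.primrec_Suc[OF Suc] rec_eval_Comp2 rec_eval_Comp1 rec_eval_Proj1
          rec_eval_Proj0 rec_eval.succ add[rule_format])+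
  qed
  then show ?thesis unfolding computable_def by blast
qed

lemma computable_pair:
  assumes "computable F" "computable G"
  shows "computable (\<lambda>x. prod_encode (F x, G x))"
proof -
  \<comment> \<open>\<open>prod_encode\<close> is the Cantor pairing, so addition and triangular
    numbers suffice.\<close>
  have "computable (\<lambda>x. triangle (F x + G x) + F x)"
    by (rule computable2_compose[OF computable2_add] computable_compose[OF computable_triangle]
        assms)+
  then show ?thesis by (simp add: prod_encode_def)
qed

text \<open>Tracks a syntactic operation by a function that is total on numbers, codes or not, so
  that it can be composed and iterated like any computable function.\<close>

definition coded :: "(qctl \<Rightarrow> qctl) \<Rightarrow> bool" where
  "coded F \<longleftrightarrow> (\<exists>h. computable h \<and> (\<forall>\<phi>. qctl_code (F \<phi>) = h (qctl_code \<phi>)))"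

lemma codedI: "computable h \<Longrightarrow> (\<And>\<phi>. qctl_code (F \<phi>) = h (qctl_code \<phi>)) \<Longrightarrow> coded F"
  by (auto simp: coded_def)

lemma coded_id: "coded (\<lambda>\<phi>. \<phi>)"
  by (rule codedI[OF computable_id]) simp

lemma coded_const: "coded (\<lambda>_. \<psi>)"
  by (rule codedI[OF computable_const]) simp

lemma coded_Neg: "coded F \<Longrightarrow> coded (\<lambda>\<phi>. Neg (F \<phi>))"
  unfolding coded_def
  by (elim exE conjE, rule exI, rule conjI, rule computable_pair[OF computable_const]) auto

lemma coded_ENext: "coded F \<Longrightarrow> coded (\<lambda>\<phi>. ENext (F \<phi>))"
  unfolding coded_def
  by (elim exE conjE, rule exI, rule conjI, rule computable_pair[OF computable_const]) auto

lemma coded_Exists: "coded F \<Longrightarrow> coded (\<lambda>\<phi>. Exists p (F \<phi>))"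
  unfolding coded_def
  by (elim exE conjE, rule exI, rule conjI,
      rule computable_pair[OF computable_const computable_pair[OF computable_const]]) auto

lemma coded_Or: "coded F \<Longrightarrow> coded G \<Longrightarrow> coded (\<lambda>\<phi>. Or (F \<phi>) (G \<phi>))"
proof -
  assume "coded F" "coded G"
  then obtain f g where "computable f" "\<forall>\<phi>. qctl_code (F \<phi>) = f (qctl_code \<phi>)"
    "computable g" "\<forall>\<phi>. qctl_code (G \<phi>) = g (qctl_code \<phi>)"
    unfolding coded_def by blast
  then show ?thesis
    by (intro codedI[where h = "\<lambda>x. prod_encode (2, prod_encode (f x, g x))"]
        computable_pair[where F = "\<lambda>_. 2"] computable_pair[of f g] computable_const) auto
qed

lemma computable_coded_funpow:
  assumes "coded F"
  shows "computable (\<lambda>n. qctl_code ((F ^^ n) \<phi>))"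
proof -
  obtain h where h: "computable h" "\<And>\<phi>. qctl_code (F \<phi>) = h (qctl_code \<phi>)"
    using assms coded_def by auto
  have "qctl_code ((F ^^ n) \<phi>) = (h ^^ n) (qctl_code \<phi>)" for n
    by (induction n) (simp_all add: h(2))
  then show ?thesis using computable_funpow[OF h(1)] by simp
qed

lemma computable_coded:
  assumes "coded F" "computable (\<lambda>n. qctl_code (G n))"
  shows "computable (\<lambda>n. qctl_code (F (G n)))"
proof -
  obtain h where "computable h" "\<And>\<phi>. qctl_code (F \<phi>) = h (qctl_code \<phi>)"
    using assms(1) coded_def by auto
  then show ?thesis using computable_compose[of h] assms(2) by simp
qed


section \<open>Derived operators and vacuous quantification\<close>

primrec props :: "qctl \<Rightarrow> ap set" where
  "props (Prop p) = {p}"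
| "props (Neg \<phi>) = props \<phi>"
| "props (Or \<phi> \<psi>) = props \<phi> \<union> props \<psi>"
| "props (EUntil \<phi> \<psi>) = props \<phi> \<union> props \<psi>"
| "props (AUntil \<phi> \<psi>) = props \<phi> \<union> props \<psi>"
| "props (ENext \<phi>) = props \<phi>"
| "props (ANext \<phi>) = props \<phi>"
| "props (Exists p \<phi>) = insert p (props \<phi>)"

lemma kripke_structure_label [simp]:
  "kripke_structure (S\<lparr>label := l\<rparr>) \<longleftrightarrow> kripke_structure S"
  by (simp add: kripke_structure_def)

lemma path_from_label [simp]: "path_from (S\<lparr>label := l\<rparr>) q \<rho> \<longleftrightarrow> path_from S q \<rho>"
  by (simp add: path_from_def)

lemma agree_except_iff: "agree_except S p l \<longleftrightarrow> (\<forall>s\<in>states S. \<forall>r. r \<noteq> p \<longrightarrow> r \<in> l s \<longleftrightarrow> r \<in> label S s)"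
  by (auto simp: agree_except_def)

text \<open>Paths and successors stay inside \<open>states S\<close>, the only place where
  \<open>agree_except\<close> constrains labels, so membership is carried through the induction.
  Restriction to \<open>CTL\<close> avoids comparing nested relabellings.\<close>

lemma sat_fresh:
  assumes "kripke_structure S" "q \<in> states S" "CTL \<phi>" "z \<notin> props \<phi>" "agree_except S z l"
  shows "sat (S\<lparr>label := l\<rparr>) q \<phi> \<longleftrightarrow> sat S q \<phi>"
  using assms(3,2,4)
proof (induction \<phi> arbitrary: q rule: CTL.induct)
  case (1 p)
  then show ?case using assms(5) by (auto simp: agree_except_iff)
next
  case (4 \<phi> \<psi>)
  have "sat (S\<lparr>label := l\<rparr>) (\<rho> i) \<phi> = sat S (\<rho> i) \<phi>" "sat (S\<lparr>label := l\<rparr>) (\<rho> i) \<psi> = sat S (\<rho> i) \<psi>"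
    if "path_from S q \<rho>" for \<rho> i
    using 4 path_from_states[OF assms(1) that] by auto
  then show ?case by (simp cong: conj_cong)
next
  case (5 \<phi> \<psi>)
  have "sat (S\<lparr>label := l\<rparr>) (\<rho> i) \<phi> = sat S (\<rho> i) \<phi>" "sat (S\<lparr>label := l\<rparr>) (\<rho> i) \<psi> = sat S (\<rho> i) \<psi>"
    if "path_from S q \<rho>" for \<rho> i
    using 5 path_from_states[OF assms(1) that] by auto
  then show ?case by simp
next
  case (6 \<phi>)
  have "q' \<in> states S" if "(q, q') \<in> transitions S" for q'
    using that assms(1) by (auto simp: kripke_structure_def)
  then show ?case using 6 by auto
next
  case (7 \<phi>)
  have "q' \<in> states S" if "(q, q') \<in> transitions S" for q'
    using that assms(1) by (auto simp: kripke_structure_def)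
  then show ?case using 7 by auto
qed auto

lemma sat_Exists_fresh:
  assumes "kripke_structure S" "q \<in> states S" "CTL \<phi>" "z \<notin> props \<phi>"
  shows "sat S q (Exists z \<phi>) \<longleftrightarrow> sat S q \<phi>"
  using sat_fresh[OF assms] by (auto simp: agree_except_def)

text \<open>Quantifying \<open>p\<close> discards its current value; this is the shadowing behind
  \<open>sat_Exists_Forall\<close> and \<open>sat_Forall_Forall\<close>.\<close>

lemma sat_Exists_label:
  assumes "agree_except S p l"
  shows "sat (S\<lparr>label := l\<rparr>) q (Exists p \<phi>) \<longleftrightarrow> sat S q (Exists p \<phi>)"
proof -
  have "agree_except (S\<lparr>label := l\<rparr>) p l' \<longleftrightarrow> agree_except S p l'" for l'
    using assms by (auto simp: agree_except_def)
  then show ?thesis by simp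
qed

lemma agree_except_refl: "agree_except S p (label S)"
  by (simp add: agree_except_def)

lemma sat_Forall: "sat S q (Forall p \<phi>) \<longleftrightarrow> (\<forall>l. agree_except S p l \<longrightarrow> sat (S\<lparr>label := l\<rparr>) q \<phi>)"
  by simp

lemma sat_Forall_label:
  "agree_except S p l \<Longrightarrow> sat (S\<lparr>label := l\<rparr>) q (Forall p \<phi>) \<longleftrightarrow> sat S q (Forall p \<phi>)"
  by (simp only: sat.simps(2) sat_Exists_label)

lemma sat_Exists_Forall: "sat S q (Exists p (Forall p \<phi>)) \<longleftrightarrow> sat S q (Forall p \<phi>)"
proof
  assume "sat S q (Exists p (Forall p \<phi>))"
  then obtain l where "agree_except S p l" "sat (S\<lparr>label := l\<rparr>) q (Forall p \<phi>)"
    unfolding sat.simps(8) by (elim exE conjE)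
  then show "sat S q (Forall p \<phi>)" by (simp only: sat_Forall_label)
next
  assume "sat S q (Forall p \<phi>)"
  then have "sat (S\<lparr>label := label S\<rparr>) q (Forall p \<phi>)"
    by (simp only: sat_Forall_label[OF agree_except_refl])
  then show "sat S q (Exists p (Forall p \<phi>))"
    unfolding sat.simps(8) by (intro exI[of _ "label S"] conjI agree_except_refl)
qed

lemma sat_Forall_Forall: "sat S q (Forall p (Forall p \<phi>)) \<longleftrightarrow> sat S q (Forall p \<phi>)"
proof
  assume "sat S q (Forall p (Forall p \<phi>))"
  then have "\<forall>l. agree_except S p l \<longrightarrow> sat (S\<lparr>label := l\<rparr>) q (Forall p \<phi>)"
    by (simp only: sat_Forall[of _ _ _ "Forall p \<phi>"])
  then have "sat (S\<lparr>label := label S\<rparr>) q (Forall p \<phi>)"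
    using agree_except_refl[of S p] by simp
  then show "sat S q (Forall p \<phi>)" by (simp only: sat_Forall_label[OF agree_except_refl])
next
  assume "sat S q (Forall p \<phi>)"
  then show "sat S q (Forall p (Forall p \<phi>))"
    unfolding sat_Forall[of _ _ _ "Forall p \<phi>"] by (intro allI impI) (simp only: sat_Forall_label)
qed

section \<open>Derived CTL operators\<close>

abbreviation And :: "qctl \<Rightarrow> qctl \<Rightarrow> qctl" where
  "And \<phi> \<psi> \<equiv> Neg (Or (Neg \<phi>) (Neg \<psi>))"

abbreviation Imp :: "qctl \<Rightarrow> qctl \<Rightarrow> qctl" where
  "Imp \<phi> \<psi> \<equiv> Or (Neg \<phi>) \<psi>"

definition Top :: qctl where
  "Top = Or (Prop 0) (Neg (Prop 0))"

primrec Conj :: "qctl list \<Rightarrow> qctl" where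
  "Conj [] = Top"
| "Conj (\<phi> # \<phi>s) = And \<phi> (Conj \<phi>s)"

definition AG :: "qctl \<Rightarrow> qctl" where
  "AG \<phi> = Neg (EUntil Top (Neg \<phi>))"

lemma sat_Top [simp]: "sat S q Top"
  by (simp add: Top_def)

lemma sat_Conj [simp]: "sat S q (Conj \<phi>s) \<longleftrightarrow> (\<forall>\<phi>\<in>set \<phi>s. sat S q \<phi>)"
  by (induction \<phi>s) auto

lemma sat_AG: "sat S q (AG \<phi>) \<longleftrightarrow> (\<forall>\<rho> i. path_from S q \<rho> \<longrightarrow> sat S (\<rho> i) \<phi>)"
  by (auto simp: AG_def)

lemma CTL_Top [simp, intro]: "CTL Top" and props_Top [simp]: "props Top = {0}"
  by (auto simp: Top_def intro: CTL.intros)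

lemma CTL_Conj: "(\<And>\<phi>. \<phi> \<in> set \<phi>s \<Longrightarrow> CTL \<phi>) \<Longrightarrow> CTL (Conj \<phi>s)"
  by (induction \<phi>s) (auto intro!: CTL.intros)

lemma props_Conj [simp]: "props (Conj \<phi>s) = insert 0 (\<Union> (props ` set \<phi>s))"
  by (induction \<phi>s) auto

lemma CTL_AG: "CTL \<phi> \<Longrightarrow> CTL (AG \<phi>)" and props_AG [simp]: "props (AG \<phi>) = insert 0 (props \<phi>)"
  by (auto simp: AG_def intro: CTL.intros)

lemma path_from_exists:
  assumes "kripke_structure S" "q \<in> states S"
  shows "\<exists>\<rho>. path_from S q \<rho>"
proof -
  have "\<exists>\<rho>. \<forall>n. (\<rho> n \<in> states S \<and> (n = 0 \<longrightarrow> \<rho> n = q)) \<and> (\<rho> n, \<rho> (Suc n)) \<in> transitions S"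
    using assms by (intro dependent_nat_choice) (auto simp: kripke_structure_def)
  then show ?thesis unfolding path_from_def by blast
qed

text \<open>Path quantifiers range over infinite paths, so the finite route to \<open>s\<close> is
  prolonged by totality.\<close>

lemma path_from_reaches:
  assumes "kripke_structure S" "q \<in> states S" "(q, s) \<in> (transitions S)\<^sup>*"
  shows "\<exists>\<rho> i. path_from S q \<rho> \<and> \<rho> i = s"
  using assms(3,2)
proof (induction rule: converse_rtrancl_induct)
  case base
  then show ?case using path_from_exists[OF assms(1)] path_from_def by metis
next
  case (step q q')
  then have "q' \<in> states S" using assms(1) by (auto simp: kripke_structure_def)
  then obtain \<rho> i where "path_from S q' \<rho>" "\<rho> i = s" using step by blast
  then have "path_from S q (case_nat q \<rho>)" "case_nat q \<rho> (Suc i) = s"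
    using step(1) by (auto simp: path_from_def split: nat.split)
  then show ?case by blast
qed

lemma sat_AG_reachable:
  assumes "kripke_structure S" "q \<in> states S" "sat S q (AG \<phi>)" "(q, s) \<in> (transitions S)\<^sup>*"
  shows "sat S s \<phi>"
  using path_from_reaches[OF assms(1,2,4)] assms(3) by (auto simp: sat_AG)


section \<open>Constraints on binary pointer graphs\<close>

text \<open>Countability supplies \<open>to_nat\<close>, which will turn marks into atomic
  propositions.\<close>

instance recf :: countable by countable_datatype

datatype mark = Leaf | Eval recf | Evals "recf list" | Search recf

instance mark :: countable by countable_datatype

text \<open>Every node has two pointers, selected by a Boolean (\<^term>\<open>False\<close> is left); lists of Booleans
  are paths.\<close>

datatype constraint =
    Same "bool list" "bool list"
  | Marked bool "bool list" mark
  | When bool "bool list" mark constraint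

primrec walk :: "(bool \<Rightarrow> 's \<Rightarrow> 's) \<Rightarrow> bool list \<Rightarrow> 's \<Rightarrow> 's" where
  "walk T [] s = s"
| "walk T (b # \<pi>) s = walk T \<pi> (T b s)"

lemma walk_append [simp]: "walk T (\<pi> @ \<sigma>) s = walk T \<sigma> (walk T \<pi> s)"
  by (induction \<pi> arbitrary: s) auto

primrec holds :: "(bool \<Rightarrow> 's \<Rightarrow> 's) \<Rightarrow> ('s \<Rightarrow> mark \<Rightarrow> bool) \<Rightarrow> 's \<Rightarrow> constraint \<Rightarrow> bool" where
  "holds T has s (Same \<pi> \<sigma>) \<longleftrightarrow> walk T \<pi> s = walk T \<sigma> s"
| "holds T has s (Marked b \<pi> m) \<longleftrightarrow> has (walk T \<pi> s) m = b"
| "holds T has s (When b \<pi> m c) \<longleftrightarrow> (has (walk T \<pi> s) m = b \<longrightarrow> holds T has s c)"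

text \<open>Pointers are binary, so the four fields of an inference step occupy two levels: argument
  and result under the left pointer, the premises under the right one.\<close>

abbreviation "arg \<equiv> [False, False]"
abbreviation "res \<equiv> [False, True]"
abbreviation "prem1 \<equiv> [True, False]"
abbreviation "prem2 \<equiv> [True, True]"
abbreviation hd_of :: "bool list \<Rightarrow> bool list" where "hd_of \<pi> \<equiv> \<pi> @ [False]"
abbreviation tl_of :: "bool list \<Rightarrow> bool list" where "tl_of \<pi> \<equiv> \<pi> @ [True]"
abbreviation is_leaf :: "bool list \<Rightarrow> constraint" where "is_leaf \<pi> \<equiv> Marked True \<pi> Leaf"
abbreviation is_branch :: "bool list \<Rightarrow> constraint" where "is_branch \<pi> \<equiv> Marked False \<pi> Leaf"
abbreviation has_mark :: "bool list \<Rightarrow> mark \<Rightarrow> constraint" where "has_mark \<pi> m \<equiv> Marked True \<pi> m"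
abbreviation if_leaf :: "bool list \<Rightarrow> constraint \<Rightarrow> constraint" where
  "if_leaf \<pi> c \<equiv> When True \<pi> Leaf c"
abbreviation if_branch :: "bool list \<Rightarrow> constraint \<Rightarrow> constraint" where
  "if_branch \<pi> c \<equiv> When False \<pi> Leaf c"

text \<open>A number is represented by the length of the right spine of a node, a list by the numbers
  hanging off that spine. A node marked \<open>Eval f\<close> is an inference step of a derivation of
  \<open>rec_eval f xs y\<close>: its paths \<^term>\<open>arg\<close> and \<^term>\<open>res\<close> lead to \<open>xs\<close> and \<open>y\<close>, and
  \<^term>\<open>prem1\<close> and \<^term>\<open>prem2\<close> to the derivations of its premises. \<open>Evals gs\<close> evaluates
  all of \<open>gs\<close> on the same arguments; \<open>Search f\<close> with argument \<open>n # xs\<close> states that \<open>f\<close> is positive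
  on all \<open>m # xs\<close> with \<open>m < n\<close> (its result is irrelevant).\<close>

fun rules :: "mark \<Rightarrow> constraint list" where
  "rules Leaf = []"
| "rules (Eval Zero) = [is_leaf res]"
| "rules (Eval Succ) =
    [is_branch arg, is_leaf (tl_of arg), is_branch res, Same (tl_of res) (hd_of arg)]"
| "rules (Eval (Proj i)) =
    Same (hd_of (arg @ replicate i True)) res #
    map (\<lambda>j. is_branch (arg @ replicate j True)) [0..<Suc i]"
| "rules (Eval (Comp f gs)) =
    [has_mark prem1 (Evals gs), has_mark prem2 (Eval f), Same (prem1 @ arg) arg,
     Same (prem2 @ arg) (prem1 @ res), Same (prem2 @ res) res]"
| "rules (Evals []) = [is_leaf res]"
| "rules (Evals (g # gs)) =
    [has_mark prem1 (Eval g), has_mark prem2 (Evals gs), is_branch res, Same (prem1 @ arg) arg,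
     Same (prem2 @ arg) arg, Same (prem1 @ res) (hd_of res), Same (prem2 @ res) (tl_of res)]"
| "rules (Eval (PrimRec f g)) =
    is_branch arg #
    map (if_leaf (hd_of arg))
      [has_mark prem1 (Eval f), Same (prem1 @ arg) (tl_of arg), Same (prem1 @ res) res] @
    map (if_branch (hd_of arg))
      [has_mark prem1 (Eval (PrimRec f g)), has_mark prem2 (Eval g),
       is_branch (prem1 @ arg), Same (hd_of (prem1 @ arg)) (tl_of (hd_of arg)),
       Same (tl_of (prem1 @ arg)) (tl_of arg),
       is_branch (prem2 @ arg), Same (hd_of (prem2 @ arg)) (tl_of (hd_of arg)),
       is_branch (tl_of (prem2 @ arg)), Same (hd_of (tl_of (prem2 @ arg))) (prem1 @ res),
       Same (tl_of (tl_of (prem2 @ arg))) (tl_of arg), Same (prem2 @ res) res]"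
| "rules (Eval (Mu f)) =
    [has_mark prem1 (Search f), has_mark prem2 (Eval f), is_branch (prem1 @ arg),
     Same (hd_of (prem1 @ arg)) res, Same (tl_of (prem1 @ arg)) arg,
     Same (prem2 @ arg) (prem1 @ arg), is_leaf (prem2 @ res)]"
| "rules (Search f) =
    is_branch arg #
    map (if_branch (hd_of arg))
      [has_mark prem1 (Search f), has_mark prem2 (Eval f), is_branch (prem1 @ arg),
       Same (hd_of (prem1 @ arg)) (tl_of (hd_of arg)), Same (tl_of (prem1 @ arg)) (tl_of arg),
       Same (prem2 @ arg) (prem1 @ arg), is_branch (prem2 @ res)]"

text \<open>The two additional constraints make the premises of a node smaller than the node.\<close>

definition all_rules :: "mark \<Rightarrow> constraint list" where
  "all_rules m = is_branch [] # is_branch [True] # rules m"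

section \<open>Finite sets of marks closed under premises\<close>

fun prems_of :: "mark \<Rightarrow> mark set" where
  "prems_of (Eval (Comp f gs)) = {Evals gs, Eval f}"
| "prems_of (Evals (g # gs)) = {Eval g, Evals gs}"
| "prems_of (Eval (PrimRec f g)) = {Eval (PrimRec f g), Eval f, Eval g}"
| "prems_of (Eval (Mu f)) = {Search f, Eval f}"
| "prems_of (Search f) = {Search f, Eval f}"
| "prems_of _ = {}"

definition prem_closed :: "mark set \<Rightarrow> bool" where
  "prem_closed M \<longleftrightarrow> (\<forall>m\<in>M. prems_of m \<subseteq> M)"

lemma prem_closed_Un: "prem_closed M \<Longrightarrow> prem_closed M' \<Longrightarrow> prem_closed (M \<union> M')"
  by (auto simp: prem_closed_def)

lemma prem_closed_insert: "prem_closed M \<Longrightarrow> prems_of m \<subseteq> insert m M \<Longrightarrow> prem_closed (insert m M)"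
  by (auto simp: prem_closed_def)

text \<open>A formula can state the rules of finitely many marks only. Premises lead to subterms,
  suffixes of the function list of \<open>Comp\<close>, a \<open>Search\<close>, or back to the same
  mark. \<open>Leaf\<close> is kept out because its rules would demand that leaves be
  branches.\<close>

lemma finite_prem_closed:
  "\<exists>M. finite M \<and> prem_closed M \<and> Eval f \<in> M \<and> Leaf \<notin> M"
proof (induction f)
  case Zero
  show ?case by (rule exI[of _ "{Eval Zero}"]) (simp add: prem_closed_def)
next
  case Succ
  show ?case by (rule exI[of _ "{Eval Succ}"]) (simp add: prem_closed_def)
next
  case (Proj i)
  show ?case by (rule exI[of _ "{Eval (Proj i)}"]) (simp add: prem_closed_def)
next
  case (Comp f gs)
  have "\<exists>M. finite M \<and> prem_closed M \<and> Evals gs \<in> M \<and> Leaf \<notin> M"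
    using Comp.IH(2)
  proof (induction gs)
    case Nil
    show ?case by (rule exI[of _ "{Evals []}"]) (simp add: prem_closed_def)
  next
    case (Cons g gs)
    then obtain M M' where "finite M" "prem_closed M" "Evals gs \<in> M" "Leaf \<notin> M"
      "finite M'" "prem_closed M'" "Eval g \<in> M'" "Leaf \<notin> M'"
      by (metis list.set_intros)
    then show ?case
      by (intro exI[of _ "insert (Evals (g # gs)) (M \<union> M')"] conjI prem_closed_insert
          prem_closed_Un) auto
  qed
  then obtain M M' where "finite M" "prem_closed M" "Evals gs \<in> M" "Leaf \<notin> M"
      "finite M'" "prem_closed M'" "Eval f \<in> M'" "Leaf \<notin> M'"
    using Comp.IH(1) by blast
  then show ?case
    by (intro exI[of _ "insert (Eval (Comp f gs)) (M \<union> M')"] conjI prem_closed_insert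
          prem_closed_Un) auto
next
  case (PrimRec f g)
  then obtain M M' where "finite M" "prem_closed M" "Eval g \<in> M" "Leaf \<notin> M"
      "finite M'" "prem_closed M'" "Eval f \<in> M'" "Leaf \<notin> M'"
    by blast
  then show ?case
    by (intro exI[of _ "insert (Eval (PrimRec f g)) (M \<union> M')"] conjI prem_closed_insert
          prem_closed_Un) auto
next
  case (Mu f)
  then obtain M where "finite M" "prem_closed M" "Eval f \<in> M" "Leaf \<notin> M"
    by blast
  then show ?case
    by (intro exI[of _ "insert (Eval (Mu f)) (insert (Search f) M)"] conjI prem_closed_insert)
      auto
qed

text \<open>The common abstraction of an arbitrary model and of a derivation tree. Pointers out of
  leaves may loop, so only those out of other nodes have to be well-founded.\<close>

locale pointer_graph =
  fixes N :: "'s set" and T :: "bool \<Rightarrow> 's \<Rightarrow> 's" and has :: "'s \<Rightarrow> mark \<Rightarrow> bool"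
  assumes closed: "s \<in> N \<Longrightarrow> T b s \<in> N"
    and wf: "wf {(T b s, s) | b s. s \<in> N \<and> \<not> has s Leaf}"
begin

lemma graph_induct [consumes 1, case_names node]:
  assumes "s \<in> N"
    and "\<And>s. s \<in> N \<Longrightarrow> (\<And>b. \<not> has s Leaf \<Longrightarrow> P (T b s)) \<Longrightarrow> P s"
  shows "P s"
  using wf assms(1)
proof (induction s rule: wf_induct_rule)
  case (less s)
  have "P (T b s)" if "\<not> has s Leaf" for b
    using less that closed[of s b] by blast
  with less.prems show ?case by (rule assms(2))
qed

text \<open>A graph offers no structural recursion, hence \<open>LEAST\<close>;
  \<open>num_branch\<close> and \<open>lst_branch\<close> recover the recursion equations.\<close>

definition num :: "'s \<Rightarrow> nat" where
  "num s = (LEAST n. has ((T True ^^ n) s) Leaf)"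

definition lst :: "'s \<Rightarrow> nat list" where
  "lst s = map (\<lambda>i. num (T False ((T True ^^ i) s))) [0..<num s]"

lemma spine_ends: "s \<in> N \<Longrightarrow> \<exists>n. has ((T True ^^ n) s) Leaf"
proof (induction s rule: graph_induct)
  case (node s)
  show ?case
  proof (cases "has s Leaf")
    case True
    then show ?thesis by (intro exI[of _ 0]) simp
  next
    case False
    with node obtain n where "has ((T True ^^ n) (T True s)) Leaf" by blast
    then show ?thesis by (intro exI[of _ "Suc n"]) (simp add: funpow_swap1)
  qed
qed

lemma num_Leaf: "has s Leaf \<Longrightarrow> num s = 0"
  unfolding num_def by (rule Least_eq_0) simp

lemma num_branch: "s \<in> N \<Longrightarrow> \<not> has s Leaf \<Longrightarrow> num s = Suc (num (T True s))"
proof -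
  assume "s \<in> N" "\<not> has s Leaf"
  then obtain n where "has ((T True ^^ n) s) Leaf" using spine_ends by blast
  then have "(LEAST n. has ((T True ^^ n) s) Leaf) = Suc (LEAST n. has ((T True ^^ Suc n) s) Leaf)"
    using \<open>\<not> has s Leaf\<close> by (intro Least_Suc) simp_all
  then show ?thesis by (simp add: num_def funpow_swap1)
qed

lemma lst_Leaf: "has s Leaf \<Longrightarrow> lst s = []"
  by (simp add: lst_def num_Leaf)

lemma lst_branch: "s \<in> N \<Longrightarrow> \<not> has s Leaf \<Longrightarrow> lst s = num (T False s) # lst (T True s)"
  by (simp add: lst_def num_branch map_upt_Suc funpow_swap1 del: upt_Suc)

lemma lst_nth:
  assumes "s \<in> N" "\<forall>j<Suc i. \<not> has (walk T (replicate j True) s) Leaf"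
  shows "i < length (lst s) \<and> lst s ! i = num (T False (walk T (replicate i True) s))"
  using assms
proof (induction i arbitrary: s)
  case 0
  then show ?case by (simp add: lst_branch)
next
  case (Suc i)
  have "\<not> has (walk T (replicate j True) (T True s)) Leaf" if "j < Suc i" for j
    using Suc.prems(2)[rule_format, of "Suc j"] that by simp
  moreover have "\<not> has s Leaf" using Suc.prems(2)[rule_format, of 0] by simp
  ultimately show ?case using Suc by (simp add: lst_branch closed)
qed

text \<open>The soundness invariant. For \<open>Search\<close> it is the minimality condition of
  \<open>rec_eval.mu\<close>.\<close>

primrec correct :: "mark \<Rightarrow> 's \<Rightarrow> 's \<Rightarrow> bool" where
  "correct Leaf x y \<longleftrightarrow> True"
| "correct (Eval f) x y \<longleftrightarrow> rec_eval f (lst x) (num y)"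
| "correct (Evals gs) x y \<longleftrightarrow> list_all2 (\<lambda>g. rec_eval g (lst x)) gs (lst y)"
| "correct (Search f) x y \<longleftrightarrow>
    (\<exists>n xs. lst x = n # xs \<and> (\<forall>m<n. \<exists>y. y > 0 \<and> rec_eval f (m # xs) y))"

text \<open>The equations for \<open>num\<close> and \<open>lst\<close> turn the pointer constraints
  into equations between numbers and lists; each rule set then matches a clause of
  \<open>rec_eval\<close> or of \<open>correct\<close>.\<close>

lemma rules_correct:
  assumes s: "s \<in> N"
    and rules: "\<forall>c\<in>set (rules m). holds T has s c"
    and prem: "\<And>b m'. m' \<in> prems_of m \<Longrightarrow> has (T b (T True s)) m' \<Longrightarrow>
      correct m' (walk T arg (T b (T True s))) (walk T res (T b (T True s)))"
  shows "correct m (walk T arg s) (walk T res s)"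
proof -
  note [simp] = s closed num_Leaf num_branch lst_Leaf lst_branch
  show ?thesis
  proof (cases m rule: rules.cases)
    case 1
    then show ?thesis by simp
  next
    case 2
    then show ?thesis using rules by (simp add: rec_eval.zero)
  next
    case 3
    then show ?thesis using rules by (simp add: rec_eval.succ)
  next
    case (4 i)
    have "\<forall>j<Suc i. \<not> has (walk T (replicate j True) (walk T arg s)) Leaf"
      using rules 4 by (auto simp: less_Suc_eq)
    then have "i < length (lst (walk T arg s))"
      "lst (walk T arg s) ! i = num (T False (walk T (replicate i True) (walk T arg s)))"
      using lst_nth[of "walk T arg s" i] by simp_all
    then show ?thesis
      using rec_eval.proj[of i "lst (walk T arg s)"] rules 4 by simp
  next
    case (5 f gs)
    show ?thesis
      using 5 rules prem[of "Evals gs" False] prem[of "Eval f" True]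
      by (simp add: rec_eval.comp)
  next
    case 6
    then show ?thesis using rules by simp
  next
    case (7 g gs)
    then show ?thesis
      using rules prem[of "Eval g" False] prem[of "Evals gs" True] by simp
  next
    case (8 f g)
    show ?thesis
    proof (cases "has (walk T (hd_of arg) s) Leaf")
      case True
      then show ?thesis
        using 8 rules prem[of "Eval f" False] by (simp add: rec_eval.primrec_0)
    next
      case False
      then show ?thesis
        using 8 rules prem[of "Eval (PrimRec f g)" False] prem[of "Eval g" True]
        by (simp add: rec_eval.primrec_Suc)
    qed
  next
    case (9 f)
    show ?thesis
      using 9 rules prem[of "Search f" False] prem[of "Eval f" True]
      by (auto intro: rec_eval.mu)
  next
    case (10 f)
    show ?thesis
    proof (cases "has (walk T (hd_of arg) s) Leaf")
      case True
      then show ?thesis using 10 rules by simp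
    next
      \<comment> \<open>The values below a successor are those below the predecessor, covered by the
        \<open>Search\<close> premise, and the predecessor itself, covered by the
        \<open>Eval\<close> premise.\<close>
      case False
      then show ?thesis
        using 10 rules prem[of "Search f" False] prem[of "Eval f" True]
        by (auto simp: less_Suc_eq)
    qed
  qed
qed

lemma marked_correct:
  assumes "s \<in> N" "prem_closed M" "Leaf \<notin> M" "m \<in> M" "has s m"
    and rules: "\<And>s m c. s \<in> N \<Longrightarrow> m \<in> M \<Longrightarrow> has s m \<Longrightarrow> c \<in> set (all_rules m) \<Longrightarrow> holds T has s c"
  shows "correct m (walk T arg s) (walk T res s)"
proof -
  define P where
    "P s \<longleftrightarrow> (\<forall>m\<in>M. has s m \<longrightarrow> correct m (walk T arg s) (walk T res s))" for s
  have PI: "P s"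
    if s: "s \<in> N" and IH: "\<And>b. \<not> has s Leaf \<Longrightarrow> \<not> has (T True s) Leaf \<Longrightarrow> P (T b (T True s))" for s
    unfolding P_def
  proof (intro ballI impI)
    fix m assume m: "m \<in> M" "has s m"
    have *: "holds T has s c" if "c \<in> set (all_rules m)" for c
      by (rule rules[OF s m that])
    have "\<not> has s Leaf" "\<not> has (T True s) Leaf"
      using *[of "is_branch []"] *[of "is_branch [True]"] by (simp_all add: all_rules_def)
    then have P: "P (T b (T True s))" for b by (rule IH)
    show "correct m (walk T arg s) (walk T res s)"
    proof (rule rules_correct[OF s])
      show "\<forall>c\<in>set (rules m). holds T has s c"
        using * by (simp add: all_rules_def)
      fix b m' assume "m' \<in> prems_of m" "has (T b (T True s)) m'"
      moreover from this have "m' \<in> M" using assms(2) m(1) by (auto simp: prem_closed_def)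
      ultimately show "correct m' (walk T arg (T b (T True s))) (walk T res (T b (T True s)))"
        using P[of b] unfolding P_def by blast
    qed
  qed
  \<comment> \<open>Strengthened by one level: an induction step descends one pointer, but premises
    lie two pointers below. The additional constraints of \<open>all_rules\<close> make both
    pointers leave branches.\<close>
  have "P s \<and> (\<not> has s Leaf \<longrightarrow> (\<forall>b. P (T b s)))"
    using assms(1)
  proof (induction s rule: graph_induct)
    case (node s)
    have "P s" using node(2) by (intro PI[OF node(1)]) blast
    moreover have "P (T b s)" if "\<not> has s Leaf" for b using node(2)[OF that] by blast
    ultimately show ?case by blast
  qed
  then show ?thesis using assms(4,5) unfolding P_def by blast
qed

end

section \<open>Derivation trees\<close>

text \<open>The nodes of the model will be the subtrees themselves. Equal subtrees are then one
  node, so \<open>Same\<close> between two copies of the same data is plain equality of trees.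
  \<open>Tip\<close> is its own child, which keeps pointers total.\<close>

datatype tree = Tip | Branch "mark option" tree tree

primrec child :: "bool \<Rightarrow> tree \<Rightarrow> tree" where
  "child b Tip = Tip"
| "child b (Branch x l r) = (if b then r else l)"

primrec marked :: "tree \<Rightarrow> mark \<Rightarrow> bool" where
  "marked Tip m \<longleftrightarrow> m = Leaf"
| "marked (Branch x l r) m \<longleftrightarrow> x = Some m"

primrec subtrees :: "tree \<Rightarrow> tree set" where
  "subtrees Tip = {Tip}"
| "subtrees (Branch x l r) = insert (Branch x l r) (subtrees l \<union> subtrees r)"

primrec good :: "tree \<Rightarrow> bool" where
  "good Tip \<longleftrightarrow> True"
| "good (Branch x l r) \<longleftrightarrow> good l \<and> good r \<and>
    (\<forall>m. x = Some m \<longrightarrow> (\<forall>c\<in>set (all_rules m). holds child marked (Branch x l r) c))"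

lemma subtrees_self [simp]: "t \<in> subtrees t"
  by (cases t) auto

lemma finite_subtrees: "finite (subtrees t)"
  by (induction t) auto

lemma child_subtrees: "s \<in> subtrees t \<Longrightarrow> child b s \<in> subtrees t"
  by (induction t) auto

lemma good_holds:
  "good t \<Longrightarrow> s \<in> subtrees t \<Longrightarrow> marked s m \<Longrightarrow> m \<noteq> Leaf \<Longrightarrow> c \<in> set (all_rules m) \<Longrightarrow>
    holds child marked s c"
  by (induction t) auto

lemma wf_child: "wf {(child b s, s) | b s. s \<in> N \<and> \<not> marked s Leaf}"
proof (rule wf_subset[OF wf_measure[of size]])
  have "size (child b s) < size s" if "\<not> marked s Leaf" for b s
    using that by (cases s) auto
  then show "{(child b s, s) | b s. s \<in> N \<and> \<not> marked s Leaf} \<subseteq> measure size" by auto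
qed

lemma pointer_graph_subtrees: "pointer_graph (subtrees t) child marked"
  using child_subtrees wf_child by unfold_locales

primrec num_tree :: "nat \<Rightarrow> tree" where
  "num_tree 0 = Tip"
| "num_tree (Suc n) = Branch None Tip (num_tree n)"

primrec list_tree :: "nat list \<Rightarrow> tree" where
  "list_tree [] = Tip"
| "list_tree (x # xs) = Branch None (num_tree x) (list_tree xs)"

lemma good_num_tree [simp]: "good (num_tree n)"
  by (induction n) auto

lemma good_list_tree [simp]: "good (list_tree xs)"
  by (induction xs) auto

lemma walk_list_tree: "i \<le> length xs \<Longrightarrow> walk child (replicate i True) (list_tree xs) = list_tree (drop i xs)"
proof (induction i arbitrary: xs)
  case (Suc i)
  then show ?case by (cases xs) auto
qed simp

section \<open>Trees for all computations\<close>

definition inference :: "mark \<Rightarrow> tree \<Rightarrow> tree \<Rightarrow> tree \<Rightarrow> tree \<Rightarrow> tree" where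
  "inference m x y p q = Branch (Some m) (Branch None x y) (Branch None p q)"

definition derivable :: "mark \<Rightarrow> tree \<Rightarrow> tree \<Rightarrow> bool" where
  "derivable m x y \<longleftrightarrow> (\<exists>p q. good (inference m x y p q))"

lemma child_inference [simp]:
  "child False (inference m x y p q) = Branch None x y"
  "child True (inference m x y p q) = Branch None p q"
  by (simp_all add: inference_def)

lemma marked_inference [simp]: "marked (inference m x y p q) m' \<longleftrightarrow> m' = m"
  by (auto simp: inference_def)

lemma derivableI:
  assumes "good x" "good y" "good p" "good q" "m \<noteq> Leaf"
    and "\<forall>c\<in>set (rules m). holds child marked (inference m x y p q) c"
  shows "derivable m x y"
proof -
  have "good (inference m x y p q)"
    using assms unfolding inference_def by (simp add: all_rules_def)
  then show ?thesis unfolding derivable_def by blast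
qed

lemma derivableE:
  assumes "derivable m x y"
  obtains t where "good t" "marked t m" "walk child arg t = x" "walk child res t = y"
  using assms unfolding derivable_def by force

lemma derivable_Evals:
  assumes "list_all2 (\<lambda>g y. derivable (Eval g) x (num_tree y)) gs ys" "good x"
  shows "derivable (Evals gs) x (list_tree ys)"
  using assms(1)
proof (induction rule: list_all2_induct)
  case Nil
  show ?case using assms(2) by (intro derivableI[where p = Tip and q = Tip]) auto
next
  case (Cons g gs y ys)
  obtain p where "good p" "marked p (Eval g)" "walk child arg p = x" "walk child res p = num_tree y"
    using Cons(1) by (rule derivableE)
  moreover obtain q where "good q" "marked q (Evals gs)" "walk child arg q = x"
    "walk child res q = list_tree ys"
    using Cons.IH by (rule derivableE)
  ultimately show ?case using assms(2) by (intro derivableI[where p = p and q = q]) auto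
qed

text \<open>Each step extends the search below \<open>n\<close> by the evaluation at
  \<open>n\<close> itself; \<open>Tip\<close> fills the result slot.\<close>

lemma derivable_Search:
  assumes "\<forall>m<n. \<exists>y. y > 0 \<and> derivable (Eval f) (list_tree (m # xs)) (num_tree y)"
  shows "derivable (Search f) (list_tree (n # xs)) Tip"
  using assms
proof (induction n)
  case 0
  show ?case by (intro derivableI[where p = Tip and q = Tip]) auto
next
  case (Suc n)
  then have "derivable (Search f) (list_tree (n # xs)) Tip" by simp
  then obtain p where "good p" "marked p (Search f)" "walk child arg p = list_tree (n # xs)"
    by (rule derivableE)
  moreover obtain y where y: "y > 0" "derivable (Eval f) (list_tree (n # xs)) (num_tree y)"
    using Suc.prems by blast
  moreover obtain q where "good q" "marked q (Eval f)" "walk child arg q = list_tree (n # xs)"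
    "walk child res q = num_tree y"
    using y(2) by (rule derivableE)
  ultimately show ?case
    by (intro derivableI[where p = p and q = q]) (auto simp: gr0_conv_Suc)
qed

lemma rec_eval_derivable:
  "rec_eval f xs y \<Longrightarrow> derivable (Eval f) (list_tree xs) (num_tree y)"
proof (induction rule: rec_eval.induct)
  case (zero xs)
  show ?case by (intro derivableI[where p = Tip and q = Tip]) auto
next
  case (succ x)
  show ?case by (intro derivableI[where p = Tip and q = Tip]) auto
next
  case (proj i xs)
  have "child False (list_tree (drop i xs)) = num_tree (xs ! i)"
    using proj by (simp add: Cons_nth_drop_Suc[symmetric])
  moreover have "\<not> marked (list_tree (drop j xs)) Leaf" if "j \<le> i" for j
    using proj that by (simp add: Cons_nth_drop_Suc[symmetric])
  ultimately show ?case
    using proj by (intro derivableI[where p = Tip and q = Tip]) (auto simp: walk_list_tree)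
next
  case (comp xs gs ys f z)
  have "list_all2 (\<lambda>g y. derivable (Eval g) (list_tree xs) (num_tree y)) gs ys"
    using comp.IH(1) by (rule list_all2_mono) blast
  then have "derivable (Evals gs) (list_tree xs) (list_tree ys)"
    by (rule derivable_Evals) simp
  then obtain p where "good p" "marked p (Evals gs)" "walk child arg p = list_tree xs"
    "walk child res p = list_tree ys"
    by (rule derivableE)
  moreover obtain q where "good q" "marked q (Eval f)" "walk child arg q = list_tree ys"
    "walk child res q = num_tree z"
    using comp.IH(2) by (rule derivableE)
  ultimately show ?case by (intro derivableI[where p = p and q = q]) auto
next
  case (primrec_0 f xs y g)
  obtain p where "good p" "marked p (Eval f)" "walk child arg p = list_tree xs"
    "walk child res p = num_tree y"
    using primrec_0.IH by (rule derivableE)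
  then show ?case by (intro derivableI[where p = p and q = Tip]) auto
next
  case (primrec_Suc f g n xs y z)
  obtain p where "good p" "marked p (Eval (PrimRec f g))"
    "walk child arg p = list_tree (n # xs)" "walk child res p = num_tree y"
    using primrec_Suc.IH(1) by (rule derivableE)
  moreover obtain q where "good q" "marked q (Eval g)"
    "walk child arg q = list_tree (n # y # xs)" "walk child res q = num_tree z"
    using primrec_Suc.IH(2) by (rule derivableE)
  ultimately show ?case by (intro derivableI[where p = p and q = q]) auto
next
  case (mu f n xs)
  then have "derivable (Search f) (list_tree (n # xs)) Tip"
    by (intro derivable_Search) blast
  then obtain p where "good p" "marked p (Search f)" "walk child arg p = list_tree (n # xs)"
    by (rule derivableE)
  moreover obtain q where "good q" "marked q (Eval f)" "walk child arg q = list_tree (n # xs)"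
    "walk child res q = num_tree 0"
    using mu.IH(1) by (rule derivableE)
  ultimately show ?case by (intro derivableI[where p = p and q = q]) auto
qed

section \<open>Pointer graphs as Kripke structures\<close>

text \<open>A pointer is an intermediate state: \<^term>\<open>Dia b \<phi>\<close> holds at a node if \<open>\<phi>\<close> holds at a
  target of its \<open>b\<close>-pointer. Proposition 0 is quantified, 1 stays unused, 2 marks the nodes and
  3, 4 the pointers. Pointer states must not be leaves, since a path is only required to
  end in some leaf state.\<close>

definition prop_of :: "mark \<Rightarrow> ap" where
  "prop_of m = to_nat m + 5"

abbreviation pointer :: "bool \<Rightarrow> ap" where
  "pointer b \<equiv> (if b then 4 else 3)"

definition Dia :: "bool \<Rightarrow> qctl \<Rightarrow> qctl" where
  "Dia b \<phi> = ENext (And (And (Prop (pointer b)) (Neg (Prop (prop_of Leaf)))) (ENext \<phi>))"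

primrec Dias :: "bool list \<Rightarrow> qctl \<Rightarrow> qctl" where
  "Dias [] \<phi> = \<phi>"
| "Dias (b # \<pi>) \<phi> = Dia b (Dias \<pi> \<phi>)"

primrec formula :: "constraint \<Rightarrow> qctl" where
  "formula (Same \<pi> \<sigma>) = Imp (Dias \<pi> (Prop 0)) (Dias \<sigma> (Prop 0))"
| "formula (Marked b \<pi> m) =
    (if b then Dias \<pi> (Prop (prop_of m)) else Neg (Dias \<pi> (Prop (prop_of m))))"
| "formula (When b \<pi> m c) =
    Imp (if b then Dias \<pi> (Prop (prop_of m)) else Neg (Dias \<pi> (Prop (prop_of m)))) (formula c)"

text \<open>Required for all labellings of 0, the implication makes pointers functional: a labelling
  true at just one of two targets would violate it.\<close>

definition node_axioms :: "qctl list" where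
  "node_axioms = AUntil Top (Prop (prop_of Leaf)) #
    concat (map (\<lambda>b. [Dia b (Prop 2), Imp (Dia b (Prop 0)) (Neg (Dia b (Neg (Prop 0))))])
      [False, True])"

definition rule_axioms :: "mark list \<Rightarrow> qctl list" where
  "rule_axioms ms = concat (map (\<lambda>m. map (\<lambda>c. formula (When True [] m c)) (all_rules m)) ms)"

text \<open>The argument is only said to be a one-element list. Its value is left to
  \<open>wrong_input\<close>, so the code of this formula may itself serve as the input.\<close>

definition derivation_formula :: "recf \<Rightarrow> mark list \<Rightarrow> qctl" where
  "derivation_formula f ms = Conj
    (AG (Imp (Prop 2) (Conj (node_axioms @ rule_axioms ms))) # Prop 2 #
      map formula [has_mark [] (Eval f), is_branch arg, is_leaf (tl_of arg)])"

text \<open>A spine whose length is not \<open>n\<close> either ends early, caught by the first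
  disjunct at some level, or continues after \<open>n\<close> steps, caught by the innermost
  formula.\<close>

definition count_step :: "qctl \<Rightarrow> qctl" where
  "count_step \<phi> = Or (Prop (prop_of Leaf)) (Dia True \<phi>)"

definition wrong_input :: "nat \<Rightarrow> qctl" where
  "wrong_input n = Dias (hd_of arg) ((count_step ^^ n) (Neg (Prop (prop_of Leaf))))"

lemma prop_of_eq [simp]: "prop_of m = prop_of m' \<longleftrightarrow> m = m'"
  by (simp add: prop_of_def)

lemma prop_of_neq [simp]:
  "prop_of m \<noteq> 0" "prop_of m \<noteq> Suc 0" "prop_of m \<noteq> 2" "prop_of m \<noteq> 3" "prop_of m \<noteq> 4"
  "0 \<noteq> prop_of m" "Suc 0 \<noteq> prop_of m" "2 \<noteq> prop_of m" "3 \<noteq> prop_of m" "4 \<noteq> prop_of m"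
  by (simp_all add: prop_of_def)

lemma CTL_Dia: "CTL \<phi> \<Longrightarrow> CTL (Dia b \<phi>)"
  by (auto simp: Dia_def intro!: CTL.intros)

lemma props_Dia: "props (Dia b \<phi>) = {pointer b, prop_of Leaf} \<union> props \<phi>"
  by (auto simp: Dia_def)

lemma CTL_Dias: "CTL \<phi> \<Longrightarrow> CTL (Dias \<pi> \<phi>)"
  by (induction \<pi>) (auto intro: CTL_Dia)

lemma props_Dias: "1 \<notin> props \<phi> \<Longrightarrow> 1 \<notin> props (Dias \<pi> \<phi>)"
  by (induction \<pi>) (auto simp: props_Dia)

lemma CTL_formula: "CTL (formula c)"
  by (induction c) (auto intro!: CTL.intros CTL_Dias)

lemma props_formula: "1 \<notin> props (formula c)"
  using props_Dias[of "Prop 0"] props_Dias[of "Prop (prop_of _)"] by (induction c) auto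

lemma CTL_derivation_formula: "CTL (derivation_formula f ms)"
proof -
  have "CTL \<phi>" if "\<phi> \<in> set (node_axioms @ rule_axioms ms)" for \<phi>
    using that CTL_formula
    by (auto simp: node_axioms_def rule_axioms_def simp del: formula.simps
        intro!: CTL.intros CTL_Dia)
  then have "CTL (Conj (node_axioms @ rule_axioms ms))" by (rule CTL_Conj)
  then show ?thesis
    unfolding derivation_formula_def using CTL_formula
    by (intro CTL_Conj) (auto simp del: formula.simps intro!: CTL_AG CTL.intros)
qed

lemma props_derivation_formula: "1 \<notin> props (derivation_formula f ms)"
proof -
  have "1 \<notin> props \<phi>" if "\<phi> \<in> set (node_axioms @ rule_axioms ms)" for \<phi>
    using that props_formula
    by (auto simp: node_axioms_def rule_axioms_def props_Dia simp del: formula.simps)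
  then show ?thesis
    unfolding derivation_formula_def using props_formula by (auto simp del: formula.simps)
qed

lemma CTL_wrong_input: "CTL (wrong_input n)"
proof -
  have "CTL ((count_step ^^ n) (Neg (Prop (prop_of Leaf))))"
    by (induction n) (auto simp: count_step_def intro!: CTL.intros CTL_Dia)
  then show ?thesis unfolding wrong_input_def by (rule CTL_Dias)
qed

lemma props_wrong_input: "1 \<notin> props (wrong_input n)"
proof -
  have "1 \<notin> props ((count_step ^^ n) (Neg (Prop (prop_of Leaf))))"
    by (induction n) (auto simp: count_step_def props_Dia)
  then show ?thesis unfolding wrong_input_def by (rule props_Dias)
qed

text \<open>Interpreted with \<open>f\<close> the identity on nodes of an arbitrary model, and with
  \<open>f\<close> sending a subtree \<open>s\<close> to \<open>(s, None)\<close>. One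
  \<open>S\<close> carries one labelling of 0; other labellings are other structures over the same
  graph.\<close>

locale kripke_graph = pointer_graph N T has
  for N :: "'s set" and T :: "bool \<Rightarrow> 's \<Rightarrow> 's" and has :: "'s \<Rightarrow> mark \<Rightarrow> bool" +
  fixes S :: "'k kripke" and f :: "'s \<Rightarrow> 'k"
  assumes sat_Dia: "s \<in> N \<Longrightarrow> sat S (f s) (Dia b \<phi>) \<longleftrightarrow> sat S (f (T b s)) \<phi>"
    and label_prop_of: "s \<in> N \<Longrightarrow> prop_of m \<in> label S (f s) \<longleftrightarrow> has s m"
begin

lemma walk_closed: "s \<in> N \<Longrightarrow> walk T \<pi> s \<in> N"
  by (induction \<pi> arbitrary: s) (auto simp: closed)

lemma sat_Dias: "s \<in> N \<Longrightarrow> sat S (f s) (Dias \<pi> \<phi>) \<longleftrightarrow> sat S (f (walk T \<pi> s)) \<phi>"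
  by (induction \<pi> arbitrary: s) (auto simp: closed sat_Dia)

lemma sat_formula:
  assumes "s \<in> N"
  shows "sat S (f s) (formula (Marked b \<pi> m)) \<longleftrightarrow> holds T has s (Marked b \<pi> m)"
    and "sat S (f s) (formula (When b \<pi> m c)) \<longleftrightarrow>
      (has (walk T \<pi> s) m = b \<longrightarrow> sat S (f s) (formula c))"
    and "sat S (f s) (formula (Same \<pi> \<sigma>)) \<longleftrightarrow>
      (0 \<in> label S (f (walk T \<pi> s)) \<longrightarrow> 0 \<in> label S (f (walk T \<sigma> s)))"
  using assms by (auto simp: sat_Dias label_prop_of walk_closed)

text \<open>The converse fails for a single labelling: \<open>Same\<close> yields only an
  implication between labels.\<close>

lemma holds_sat: "s \<in> N \<Longrightarrow> holds T has s c \<Longrightarrow> sat S (f s) (formula c)"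
  by (induction c) (auto simp: sat_formula simp del: formula.simps)

lemma sat_count:
  "s \<in> N \<Longrightarrow> sat S (f s) ((count_step ^^ n) (Neg (Prop (prop_of Leaf)))) \<longleftrightarrow> num s \<noteq> n"
proof (induction n arbitrary: s)
  case 0
  then show ?case using num_Leaf num_branch by (auto simp: label_prop_of)
next
  case (Suc n)
  show ?case
  proof (cases "has s Leaf")
    case True
    with Suc.prems show ?thesis by (simp add: count_step_def label_prop_of num_Leaf)
  next
    case False
    with Suc show ?thesis
      by (simp add: count_step_def[abs_def] sat_Dia label_prop_of num_branch closed)
  qed
qed

lemma sat_wrong_input:
  "s \<in> N \<Longrightarrow> sat S (f s) (wrong_input n) \<longleftrightarrow> num (walk T (hd_of arg) s) \<noteq> n"
  unfolding wrong_input_def by (subst sat_Dias, simp, rule sat_count) (rule walk_closed)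

end

section \<open>From models to computations\<close>

lemma sat_rule_axioms:
  assumes "\<forall>\<phi>\<in>set (rule_axioms ms). sat S q \<phi>" "m \<in> set ms" "c \<in> set (all_rules m)"
  shows "sat S q (formula (When True [] m c))"
  using assms unfolding rule_axioms_def by auto

lemma sat_derivation_formula:
  "sat S q (derivation_formula f ms) \<longleftrightarrow>
    sat S q (AG (Imp (Prop 2) (Conj (node_axioms @ rule_axioms ms)))) \<and> 2 \<in> label S q \<and>
    (\<forall>c\<in>{has_mark [] (Eval f), is_branch arg, is_leaf (tl_of arg)}. sat S q (formula c))"
  unfolding derivation_formula_def by (auto simp del: formula.simps)

lemma sat_derivation_imp_rec_eval:
  fixes S :: "'s kripke"
  assumes S: "kripke_structure S" and q: "q \<in> states S"
    and sat: "\<And>l. agree_except S 0 l \<Longrightarrow>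
      sat (S\<lparr>label := l\<rparr>) q (derivation_formula f ms) \<and> \<not> sat (S\<lparr>label := l\<rparr>) q (wrong_input n)"
    and ms: "prem_closed (set ms)" "Leaf \<notin> set ms" "Eval f \<in> set ms"
  shows "\<exists>y. rec_eval f [n] y"
proof -
  \<comment> \<open>\<open>M X\<close> makes proposition 0 true exactly on \<open>X\<close>;
    singletons will separate states.\<close>
  define M where "M X = S\<lparr>label := \<lambda>s. label S s - {0} \<union> (if s \<in> X then {0} else {})\<rparr>" for X
  have M_simps [simp]: "transitions (M X) = transitions S" "states (M X) = states S"
    "p \<noteq> 0 \<Longrightarrow> p \<in> label (M X) s \<longleftrightarrow> p \<in> label S s" "0 \<in> label (M X) s \<longleftrightarrow> s \<in> X"
    "path_from (M X) s \<rho> = path_from S s \<rho>" "kripke_structure (M X)" for X p s \<rho>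
    using S by (auto simp: M_def)
  have satM: "sat (M X) q (derivation_formula f ms)" "\<not> sat (M X) q (wrong_input n)" for X
    using sat[of "\<lambda>s. label S s - {0} \<union> (if s \<in> X then {0} else {})"]
    by (simp_all add: M_def agree_except_iff)
  \<comment> \<open>Only reachable states, because \<open>AG\<close> at \<open>q\<close> is silent
    about others.\<close>
  define N where "N = {s. (q, s) \<in> (transitions S)\<^sup>* \<and> 2 \<in> label S s}"
  define target where "target b s a \<longleftrightarrow> (\<exists>m. (s, m) \<in> transitions S \<and> pointer b \<in> label S m \<and>
    prop_of Leaf \<notin> label S m \<and> (m, a) \<in> transitions S)" for b s a
  define T where "T b s = (SOME a. target b s a)" for b s
  define has where "has s m \<longleftrightarrow> prop_of m \<in> label S s" for s m
  have sat_Dia: "sat (M X) s (Dia b \<phi>) \<longleftrightarrow> (\<exists>a. target b s a \<and> sat (M X) a \<phi>)" for X s b \<phi>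
    by (auto simp: Dia_def target_def)
  have axioms: "\<forall>\<phi>\<in>set (node_axioms @ rule_axioms ms). sat (M X) s \<phi>" if "s \<in> N" for X s
  proof -
    have "sat (M X) q (AG (Imp (Prop 2) (Conj (node_axioms @ rule_axioms ms))))"
      using satM(1) unfolding sat_derivation_formula by blast
    then have "sat (M X) s (Imp (Prop 2) (Conj (node_axioms @ rule_axioms ms)))"
      using q that by (intro sat_AG_reachable[of "M X" q _ s]) (simp_all add: N_def)
    with that show ?thesis by (simp add: N_def)
  qed
  have target_node: "\<exists>a. target b s a \<and> 2 \<in> label S a" if "s \<in> N" for b s
    using axioms[OF that, of "{}"] by (cases b) (auto simp: node_axioms_def sat_Dia)
  \<comment> \<open>With 0 placed on \<open>a\<close> alone, any other target would satisfy
    \<open>Neg (Prop 0)\<close>.\<close>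
  have target_unique: "a = a'" if "s \<in> N" "target b s a" "target b s a'" for b s a a'
    using axioms[OF that(1), of "{a}"] that(2,3)
    by (cases b) (auto simp: node_axioms_def sat_Dia)
  have target_T: "target b s a \<longleftrightarrow> a = T b s" if "s \<in> N" for b s a
    unfolding T_def using target_node[OF that] target_unique[OF that] by (metis someI_ex)
  have closed: "T b s \<in> N" if s: "s \<in> N" for b s
  proof -
    have "target b s (T b s)" "2 \<in> label S (T b s)"
      using target_T[OF s] target_node[OF s, of b] by auto
    moreover have "(q, s) \<in> (transitions S)\<^sup>*" using s by (simp add: N_def)
    ultimately show ?thesis
      unfolding N_def target_def by (auto intro: rtrancl_into_rtrancl)
  qed
  have wf: "wf {(T b s, s) | b s. s \<in> N \<and> \<not> has s Leaf}"
    unfolding wf_iff_no_infinite_down_chain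
  proof
    assume "\<exists>g. \<forall>i. (g (Suc i), g i) \<in> {(T b s, s) | b s. s \<in> N \<and> \<not> has s Leaf}"
    then obtain g where g: "\<forall>i. g i \<in> N \<and> \<not> has (g i) Leaf \<and> (\<exists>b. g (Suc i) = T b (g i))"
      by auto
    have "\<exists>m. (g i, m) \<in> transitions S \<and> prop_of Leaf \<notin> label S m \<and> (m, g (Suc i)) \<in> transitions S"
      for i
    proof -
      obtain b where "g (Suc i) = T b (g i)" using g by blast
      then have "target b (g i) (g (Suc i))" using target_T g by simp
      then show ?thesis unfolding target_def by blast
    qed
    then obtain m where m: "\<And>i. (g i, m i) \<in> transitions S" "\<And>i. prop_of Leaf \<notin> label S (m i)"
      "\<And>i. (m i, g (Suc i)) \<in> transitions S"
      by metis
    \<comment> \<open>Interleaving nodes with the pointer states between them gives a path that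
      never meets a leaf, against the \<open>AUntil\<close> axiom.\<close>
    define \<rho> where "\<rho> i = (if even i then g (i div 2) else m (i div 2))" for i
    have "path_from S (g 0) \<rho>" using m(1,3) by (auto simp: path_from_def \<rho>_def elim!: oddE)
    moreover have "sat (M {}) (g 0) (AUntil Top (Prop (prop_of Leaf)))"
      using axioms[of "g 0" "{}"] g by (simp add: node_axioms_def)
    ultimately obtain i where "prop_of Leaf \<in> label S (\<rho> i)" by auto
    then show False using g m(2) by (auto simp: \<rho>_def has_def split: if_splits)
  qed
  interpret pointer_graph N T has using closed wf by unfold_locales
  have graph: "kripke_graph N T has (M X) (\<lambda>s. s)" for X
    using sat_Dia target_T by unfold_locales (auto simp: has_def)
  have holds: "holds T has s c" if "\<And>X. sat (M X) s (formula c)" "s \<in> N" for s c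
    using that(1)
  proof (induction c)
    case (Same \<pi> \<sigma>)
    \<comment> \<open>With 0 placed exactly on the end of \<open>\<pi>\<close>, the implication
      forces \<open>\<sigma>\<close> to end there too.\<close>
    then show ?case
      using kripke_graph.sat_formula(3)[OF graph that(2), of "{walk T \<pi> s}" \<pi> \<sigma>] by auto
  next
    case (Marked b \<pi> m)
    then show ?case using kripke_graph.sat_formula(1)[OF graph that(2)] by blast
  next
    case (When b \<pi> m c)
    then show ?case using kripke_graph.sat_formula(2)[OF graph that(2)] by auto
  qed
  have "q \<in> N" using satM(1)[of "{}"] by (simp add: N_def sat_derivation_formula)
  have root: "holds T has q c" if "c \<in> {has_mark [] (Eval f), is_branch arg, is_leaf (tl_of arg)}" for c
    using \<open>q \<in> N\<close> that satM(1)[unfolded sat_derivation_formula] by (intro holds) blast+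
  have "holds T has s c" if "s \<in> N" "m \<in> set ms" "has s m" "c \<in> set (all_rules m)" for s m c
  proof -
    have "sat (M X) s (formula (When True [] m c))" for X
      using axioms[OF that(1), of X] that(2,4) by (intro sat_rule_axioms) auto
    then have "holds T has s (When True [] m c)" using that(1) by (rule holds)
    with that(3) show ?thesis by simp
  qed
  moreover have "has q (Eval f)" using root[of "has_mark [] (Eval f)"] by simp
  ultimately have "correct (Eval f) (walk T arg q) (walk T res q)"
    using \<open>q \<in> N\<close> ms by (intro marked_correct[of q "set ms" "Eval f"])
  moreover have "num (walk T (hd_of arg) q) = n"
    using satM(2) kripke_graph.sat_wrong_input[OF graph \<open>q \<in> N\<close>] by blast
  moreover have "\<not> has (walk T arg q) Leaf" "has (walk T (tl_of arg) q) Leaf"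
    using root[of "is_branch arg"] root[of "is_leaf (tl_of arg)"] by simp_all
  ultimately have "rec_eval f [n] (num (walk T res q))"
    using \<open>q \<in> N\<close> by (simp add: lst_branch lst_Leaf closed)
  then show ?thesis ..
qed

section \<open>From computations to models\<close>

text \<open>\<open>(s, None)\<close> is the node \<open>s\<close>, and \<open>(s, Some b)\<close> its \<open>b\<close>-pointer.\<close>

definition tree_model :: "tree \<Rightarrow> (tree \<times> bool option) kripke" where
  "tree_model t = \<lparr>states = subtrees t \<times> UNIV,
    transitions = {((s, None), (s, Some b)) | s b. s \<in> subtrees t} \<union>
      {((s, Some b), (child b s, None)) | s b. s \<in> subtrees t},
    label = (\<lambda>(s, x). case x of
      None \<Rightarrow> insert 2 (prop_of ` {m. marked s m}) | Some b \<Rightarrow> {pointer b})\<rparr>"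

lemma tree_model_transitions [simp]:
  "((s, None), y) \<in> transitions (tree_model t) \<longleftrightarrow> s \<in> subtrees t \<and> (\<exists>b. y = (s, Some b))"
  "((s, Some b), y) \<in> transitions (tree_model t) \<longleftrightarrow> s \<in> subtrees t \<and> y = (child b s, None)"
  by (auto simp: tree_model_def)

lemma tree_model_states [simp]: "(s, x) \<in> states (tree_model t) \<longleftrightarrow> s \<in> subtrees t"
  by (simp add: tree_model_def)

lemma tree_model_label [simp]:
  "label (tree_model t) (s, None) = insert 2 (prop_of ` {m. marked s m})"
  "label (tree_model t) (s, Some b) = {pointer b}"
  by (simp_all add: tree_model_def)

lemma finite_tree_model: "finite (states (tree_model t))"
  by (simp add: tree_model_def finite_subtrees)

lemma kripke_structure_tree_model: "kripke_structure (tree_model t)"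
  unfolding kripke_structure_def
proof (intro conjI ballI)
  show "countable (states (tree_model t))"
    by (rule countable_finite[OF finite_tree_model])
  show "transitions (tree_model t) \<subseteq> states (tree_model t) \<times> states (tree_model t)"
    by (auto simp: tree_model_def child_subtrees)
  fix q assume q: "q \<in> states (tree_model t)"
  obtain s x where "q = (s, x)" by (cases q)
  with q show "\<exists>q'\<in>states (tree_model t). (q, q') \<in> transitions (tree_model t)"
    by (cases x) (auto simp: child_subtrees)
qed

text \<open>Two transitions, node to pointer and pointer to node, descend to a child.\<close>

lemma tree_model_path_ends:
  "path_from (tree_model t) (s, None) \<rho> \<Longrightarrow> \<exists>i. \<rho> i = (Tip, None)"
proof (induction s arbitrary: \<rho>)
  case Tip
  then show ?case unfolding path_from_def by blast
next
  case (Branch x l r)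
  have \<rho>: "\<rho> 0 = (Branch x l r, None)" "(\<rho> 0, \<rho> 1) \<in> transitions (tree_model t)"
    "(\<rho> 1, \<rho> 2) \<in> transitions (tree_model t)"
    using Branch.prems unfolding path_from_def numeral_2_eq_2 One_nat_def by blast+
  then obtain b where "\<rho> 2 = (child b (Branch x l r), None)" by auto
  then have path: "path_from (tree_model t) (child b (Branch x l r), None) (\<lambda>i. \<rho> (i + 2))"
    using Branch.prems by (auto simp: path_from_def numeral_2_eq_2)
  have "\<exists>i. \<rho> (i + 2) = (Tip, None)"
    using Branch.IH[of "\<lambda>i. \<rho> (i + 2)"] path by (cases b) auto
  then show ?case by blast
qed

lemma sat_tree_model:
  assumes t: "good t" "marked t (Eval f)" "walk child arg t = list_tree [n]"
    and ms: "Leaf \<notin> set ms" and l: "agree_except (tree_model t) 0 l"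
  defines "S \<equiv> tree_model t\<lparr>label := l\<rparr>"
  shows "sat S (t, None) (derivation_formula f ms) \<and> \<not> sat S (t, None) (wrong_input n)"
proof -
  have label: "p \<in> label S (s, x) \<longleftrightarrow> p \<in> label (tree_model t) (s, x)"
    if "s \<in> subtrees t" "p \<noteq> 0" for p s x
    using l that by (simp add: agree_except_iff S_def)
  have S_simps [simp]: "transitions S = transitions (tree_model t)"
    "path_from S = path_from (tree_model t)"
    by (auto simp: S_def fun_eq_iff)
  \<comment> \<open>A node has exactly one pointer state per direction, so \<open>Dia\<close> is
    deterministic whatever the labelling of 0.\<close>
  have Dia: "sat S (s, None) (Dia b \<phi>) \<longleftrightarrow> sat S (child b s, None) \<phi>" if "s \<in> subtrees t" for s b \<phi>
  proof -
    have ptr: "pointer b \<in> label S (s, Some b') \<longleftrightarrow> b' = b" "prop_of Leaf \<notin> label S (s, Some b')" for b'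
      using that by (simp_all add: label)
    have "sat S (s, None) (ENext \<chi>) \<longleftrightarrow> (\<exists>b'. sat S (s, Some b') \<chi>)" for \<chi>
      using that by auto
    moreover have "sat S (s, Some b') (ENext \<chi>) \<longleftrightarrow> sat S (child b' s, None) \<chi>" for \<chi> b'
      using that by simp
    ultimately show ?thesis
      unfolding Dia_def by (simp only: sat.simps(1-3) ptr) simp
  qed
  interpret pointer_graph "subtrees t" child marked by (rule pointer_graph_subtrees)
  interpret kripke_graph "subtrees t" child marked S "\<lambda>s. (s, None)"
    using Dia by unfold_locales (auto simp: label)
  have axioms: "sat S (s, None) \<phi>" if s: "s \<in> subtrees t" and \<phi>: "\<phi> \<in> set (node_axioms @ rule_axioms ms)"
    for s \<phi>
  proof (cases "\<phi> \<in> set node_axioms")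
    case True
    have "\<exists>i. prop_of Leaf \<in> label S (\<rho> i)" if path: "path_from (tree_model t) (s, None) \<rho>" for \<rho>
    proof -
      obtain i where i: "\<rho> i = (Tip, None)" using tree_model_path_ends[OF path] by blast
      moreover have "\<rho> i \<in> states (tree_model t)"
        using path_from_states[OF kripke_structure_tree_model path] .
      ultimately have "prop_of Leaf \<in> label S (\<rho> i)" by (simp add: label)
      then show ?thesis ..
    qed
    then show ?thesis
      using True s by (auto simp: node_axioms_def Dia label child_subtrees)
  next
    case False
    then obtain m c where mc: "m \<in> set ms" "c \<in> set (all_rules m)"
      and \<phi>_eq: "\<phi> = formula (When True [] m c)"
      using \<phi> by (auto simp: rule_axioms_def)
    have "holds child marked s (When True [] m c)"
      using good_holds[OF t(1) s] ms mc by auto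
    with s show ?thesis unfolding \<phi>_eq by (rule holds_sat)
  qed
  have "sat S (t, None) (AG (Imp (Prop 2) (Conj (node_axioms @ rule_axioms ms))))"
    unfolding sat_AG
  proof (intro allI impI)
    fix \<rho> i assume "path_from S (t, None) \<rho>"
    then have "\<rho> i \<in> states (tree_model t)"
      using path_from_states[OF kripke_structure_tree_model] by simp
    then obtain s x where sx: "\<rho> i = (s, x)" "s \<in> subtrees t" by (cases "\<rho> i") simp
    show "sat S (\<rho> i) (Imp (Prop 2) (Conj (node_axioms @ rule_axioms ms)))"
    proof (cases x)
      case None
      then show ?thesis using sx axioms by simp
    next
      case (Some b)
      then show ?thesis using sx by (simp add: label)
    qed
  qed
  moreover have "2 \<in> label S (t, None)" by (simp add: label)
  moreover have "\<forall>c\<in>{has_mark [] (Eval f), is_branch arg, is_leaf (tl_of arg)}.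
      sat S (t, None) (formula c)"
    using t(2,3) by (intro ballI holds_sat) auto
  ultimately have "sat S (t, None) (derivation_formula f ms)"
    unfolding sat_derivation_formula by blast
  moreover have "num (num_tree k) = k" if "num_tree k \<in> subtrees t" for k
    using that
  proof (induction k)
    case (Suc k)
    then have "num_tree k \<in> subtrees t" using child_subtrees[of _ t True] by force
    with Suc show ?case by (simp add: num_branch)
  qed (simp add: num_Leaf)
  moreover have "walk child (hd_of arg) t = num_tree n" using t(3) by simp
  moreover from this have "num_tree n \<in> subtrees t"
    using walk_closed[of t "hd_of arg"] by simp
  ultimately show ?thesis using sat_wrong_input[of t n] by simp
qed

text \<open>The matrix conjoins the description with the negated \<open>wrong_input\<close>, in a
  shape whose code arises by pairing from that of \<open>Neg (derivation_formula f ms)\<close>. A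
  halting run has a finite derivation tree, hence a finite model.\<close>

lemma finitely_satisfiable_iff_halts:
  assumes ms: "prem_closed (set ms)" "Leaf \<notin> set ms" "Eval f \<in> set ms"
  shows "finitely_satisfiable (Forall 0 (Neg (Or (Neg (derivation_formula f ms)) (wrong_input n))))
    \<longleftrightarrow> (\<exists>y. rec_eval f [n] y)"
proof
  assume "finitely_satisfiable (Forall 0 (Neg (Or (Neg (derivation_formula f ms)) (wrong_input n))))"
  then obtain S :: "nat kripke" and q where S: "kripke_structure S" "q \<in> states S"
    "sat S q (Forall 0 (Neg (Or (Neg (derivation_formula f ms)) (wrong_input n))))"
    unfolding finitely_satisfiable_def by blast
  show "\<exists>y. rec_eval f [n] y"
    using S(3) by (intro sat_derivation_imp_rec_eval[OF S(1,2) _ ms]) auto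
next
  assume "\<exists>y. rec_eval f [n] y"
  then obtain y where "rec_eval f [n] y" ..
  then obtain t where t: "good t" "marked t (Eval f)" "walk child arg t = list_tree [n]"
    using rec_eval_derivable by (blast elim: derivableE)
  show "finitely_satisfiable (Forall 0 (Neg (Or (Neg (derivation_formula f ms)) (wrong_input n))))"
    using kripke_structure_tree_model finite_tree_model
  proof (rule finitely_satisfiableI)
    show "(t, None) \<in> states (tree_model t)" by simp
    show "sat (tree_model t) (t, None)
        (Forall 0 (Neg (Or (Neg (derivation_formula f ms)) (wrong_input n))))"
      using sat_tree_model[OF t ms(2)] by auto
  qed
qed


section \<open>Diagonalization\<close>

text \<open>Only the innermost quantifier over 0 is effective: proposition 1 will not occur in \<open>\<phi>\<close>, and
  the outer quantifiers over 0 are shadowed.\<close>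

fun alternate :: "nat \<Rightarrow> qctl \<Rightarrow> qctl" where
  "alternate 0 \<phi> = \<phi>"
| "alternate (Suc 0) \<phi> = Forall 0 \<phi>"
| "alternate (Suc (Suc k)) \<phi> = Forall 0 (Exists (if k = 0 then 1 else 0) (alternate k \<phi>))"

lemma AQCTL_alternate: "CTL \<phi> \<Longrightarrow> k \<ge> 1 \<Longrightarrow> AQCTL k (alternate k \<phi>)"
proof (induction k \<phi> rule: alternate.induct)
  case (2 \<phi>)
  then show ?case using EQCTL_AQCTL.intros(2) by simp
next
  case (3 k \<phi>)
  have "EQCTL (Suc k) (Exists (if k = 0 then 1 else 0) (alternate k \<phi>))"
  proof (cases "k = 0")
    case True
    then show ?thesis using 3 EQCTL_AQCTL.intros(1)[of \<phi> 1] by simp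
  next
    case False
    then show ?thesis using 3 EQCTL_AQCTL.intros(5)[of k "alternate k \<phi>" 0] by simp
  qed
  then show ?case using EQCTL_AQCTL.intros(4)[of "Suc k" _ 0] by simp
qed simp

lemma coded_alternate: "coded (alternate k)"
proof (induction k rule: induct_nat_012)
  case (ge2 k)
  have "alternate (Suc (Suc k)) = (\<lambda>\<phi>. Forall 0 (Exists (if k = 0 then 1 else 0) (alternate k \<phi>)))"
    by (rule ext) simp
  with ge2(1) show ?case by (simp only: coded_Neg coded_Exists)
next
  case 0
  have "alternate 0 = (\<lambda>\<phi>. \<phi>)" by (rule ext) simp
  then show ?case by (simp only: coded_id)
next
  case 1
  have "alternate (Suc 0) = (\<lambda>\<phi>. Forall 0 \<phi>)" by (rule ext) simp
  then show ?case by (simp only: coded_Neg coded_Exists coded_id)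
qed

lemma sat_alternate:
  fixes S :: "'s kripke"
  assumes "kripke_structure S" "q \<in> states S" "CTL \<phi>" "1 \<notin> props \<phi>" "k \<ge> 1"
  shows "sat S q (alternate k \<phi>) \<longleftrightarrow> sat S q (Forall 0 \<phi>)"
  using assms
proof (induction k \<phi> arbitrary: S rule: alternate.induct)
  case (3 k \<phi>)
  show ?case
  proof (cases "k = 0")
    case True
    have "sat (S\<lparr>label := l\<rparr>) q (Exists 1 \<phi>) \<longleftrightarrow> sat (S\<lparr>label := l\<rparr>) q \<phi>" for l
      using 3 by (intro sat_Exists_fresh) simp_all
    then show ?thesis using True by simp
  next
    case False
    have "sat (S\<lparr>label := l\<rparr>) q (alternate k \<phi>) \<longleftrightarrow> sat (S\<lparr>label := l\<rparr>) q (Forall 0 \<phi>)" for l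
      using 3 False by (intro 3(1)) simp_all
    then have "sat (S\<lparr>label := l\<rparr>) q (Exists 0 (alternate k \<phi>)) \<longleftrightarrow>
        sat (S\<lparr>label := l\<rparr>) q (Forall 0 \<phi>)" for l
      using sat_Exists_Forall[of "S\<lparr>label := l\<rparr>" q 0 \<phi>] by (simp only: sat.simps(8)) simp
    then have "sat S q (Forall 0 (Exists 0 (alternate k \<phi>))) \<longleftrightarrow> sat S q (Forall 0 (Forall 0 \<phi>))"
      by (simp only: sat_Forall)
    then show ?thesis using False by (simp only: sat_Forall_Forall alternate.simps if_False)
  qed
qed simp_all

lemma coded_Dia: "coded F \<Longrightarrow> coded (\<lambda>\<phi>. Dia b (F \<phi>))"
  unfolding Dia_def by (rule coded_const coded_Neg coded_Or coded_ENext | assumption)+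

lemma coded_Dias: "coded F \<Longrightarrow> coded (\<lambda>\<phi>. Dias \<pi> (F \<phi>))"
  by (induction \<pi>) (simp_all add: coded_Dia)

lemma coded_count_step: "coded count_step"
proof -
  have "coded (\<lambda>\<phi>. Or (Prop (prop_of Leaf)) (Dia True \<phi>))"
    by (rule coded_Or coded_const coded_Dia coded_id)+
  then show ?thesis by (simp add: count_step_def[abs_def])
qed

lemma computable_wrong_input: "computable (\<lambda>n. qctl_code (wrong_input n))"
  unfolding wrong_input_def
  by (rule computable_coded[OF coded_Dias[OF coded_id] computable_coded_funpow[OF coded_count_step]])

text \<open>The diagonal function reads its input \<open>n\<close> as the code of a formula and asks the decision
  procedure whether the computation described by that formula halts on input \<open>n\<close>.\<close>

lemma undecidable_if_coded:
  assumes "coded F"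
    and F: "\<And>\<phi>. CTL \<phi> \<Longrightarrow> 1 \<notin> props \<phi> \<Longrightarrow>
      F \<phi> \<in> I \<and> (finitely_satisfiable (F \<phi>) \<longleftrightarrow> finitely_satisfiable (Forall 0 \<phi>))"
  shows "\<not> decidable_problem qctl_code I finitely_satisfiable"
proof
  assume "decidable_problem qctl_code I finitely_satisfiable"
  then obtain dec where dec:
    "\<And>\<phi>. \<phi> \<in> I \<Longrightarrow> rec_eval dec [qctl_code \<phi>] (if finitely_satisfiable \<phi> then 1 else 0)"
    unfolding decidable_problem_def by blast
  obtain h where h: "computable h" "\<And>\<phi>. qctl_code (F \<phi>) = h (qctl_code \<phi>)"
    using assms(1) unfolding coded_def by blast
  \<comment> \<open>1 and 2 are the tags of \<open>Neg\<close> and \<open>Or\<close> in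
    \<open>qctl_code\<close>; \<open>n\<close> stands for the code of the left disjunct.\<close>
  have "computable (\<lambda>n. h (prod_encode (1, prod_encode (2, prod_encode (n, qctl_code (wrong_input n))))))"
    by (rule computable_compose[OF h(1)] computable_pair computable_const computable_id
        computable_wrong_input)+
  then obtain r where r: "\<And>n. rec_eval r [n]
      (h (prod_encode (1, prod_encode (2, prod_encode (n, qctl_code (wrong_input n))))))"
    unfolding computable_def by blast
  \<comment> \<open>On \<open>[z]\<close>, \<open>Mu (Proj 1)\<close> searches for an index at which
    the constant \<open>z\<close> is 0, so \<open>diag\<close> halts iff the answer of
    \<open>dec\<close> is 0.\<close>
  define diag where "diag = Comp (Mu (Proj 1)) [Comp dec [r]]"
  obtain M where M: "finite M" "prem_closed M" "Eval diag \<in> M" "Leaf \<notin> M"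
    using finite_prem_closed by blast
  then obtain ms where ms: "set ms = M" using finite_list by blast
  define \<psi> where "\<psi> = Neg (derivation_formula diag ms)"
  \<comment> \<open>Not circular: \<open>\<psi>\<close> mentions \<open>diag\<close> but no
    input.\<close>
  define n where "n = qctl_code \<psi>"
  define \<phi> where "\<phi> = Neg (Or \<psi> (wrong_input n))"
  have "CTL \<phi>" "1 \<notin> props \<phi>"
    unfolding \<phi>_def \<psi>_def
    using CTL_derivation_formula CTL_wrong_input props_derivation_formula props_wrong_input
    by (auto intro!: CTL.intros)
  with F have \<phi>: "F \<phi> \<in> I" "finitely_satisfiable (F \<phi>) \<longleftrightarrow> finitely_satisfiable (Forall 0 \<phi>)"
    by blast+
  note \<phi>(2)
  also have "finitely_satisfiable (Forall 0 \<phi>) \<longleftrightarrow> (\<exists>y. rec_eval diag [n] y)"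
    unfolding \<phi>_def \<psi>_def using M ms by (intro finitely_satisfiable_iff_halts) auto
  finally have sat_iff: "finitely_satisfiable (F \<phi>) \<longleftrightarrow> (\<exists>y. rec_eval diag [n] y)" .
  have "rec_eval r [n] (qctl_code (F \<phi>))" using r[of n] by (simp add: h(2) \<phi>_def n_def)
  then have ask: "rec_eval (Comp dec [r]) [n] (if finitely_satisfiable (F \<phi>) then 1 else 0)"
    using dec[OF \<phi>(1)] by (rule rec_eval_Comp1)
  show False
  proof (cases "finitely_satisfiable (F \<phi>)")
    case True
    then obtain y where "rec_eval diag [n] y" using sat_iff by blast
    then obtain z where z: "rec_eval (Comp dec [r]) [n] z" "rec_eval (Mu (Proj 1)) [z] y"
      unfolding diag_def by cases (auto simp: list_all2_Cons1)
    have "z = 1" using rec_eval_deterministic[OF z(1) ask] True by simp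
    with z(2) have "rec_eval (Proj 1) [y, 1] 0" by cases auto
    then show False by cases auto
  next
    case False
    have "rec_eval (Comp dec [r]) [n] 0" using ask False by simp
    moreover have "rec_eval (Mu (Proj 1)) [0] 0"
      by (rule rec_eval.mu[OF rec_eval_Proj1]) simp
    ultimately have "rec_eval diag [n] 0"
      unfolding diag_def by (rule rec_eval_Comp1)
    with False sat_iff show False by blast
  qed
qed

lemma finitely_satisfiable_cong:
  assumes "\<And>(S :: nat kripke) q. kripke_structure S \<Longrightarrow> q \<in> states S \<Longrightarrow> sat S q \<phi> \<longleftrightarrow> sat S q \<psi>"
  shows "finitely_satisfiable \<phi> \<longleftrightarrow> finitely_satisfiable \<psi>"
  using assms unfolding finitely_satisfiable_def by blast

lemma finitely_satisfiable_alternate: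
  assumes "CTL \<phi>" "1 \<notin> props \<phi>" "k \<ge> 1"
  shows "finitely_satisfiable (alternate k \<phi>) \<longleftrightarrow> finitely_satisfiable (Forall 0 \<phi>)"
  using assms by (intro finitely_satisfiable_cong sat_alternate)

text \<open>Under the structure semantics a witness for \<open>p\<close> is a labelling of the same
  transition system, so the relabelled structure is itself a model.\<close>

lemma finitely_satisfiable_Exists:
  "finitely_satisfiable (Exists p \<phi>) \<longleftrightarrow> finitely_satisfiable \<phi>"
proof
  assume "finitely_satisfiable (Exists p \<phi>)"
  then obtain S :: "nat kripke" and q l where "kripke_structure S" "finite (states S)"
    "q \<in> states S" "sat (S\<lparr>label := l\<rparr>) q \<phi>"
    unfolding finitely_satisfiable_def by auto
  then show "finitely_satisfiable \<phi>"
    by (intro finitely_satisfiableI[of "S\<lparr>label := l\<rparr>" q]) simp_all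
next
  assume "finitely_satisfiable \<phi>"
  then obtain S :: "nat kripke" and q where "kripke_structure S" "finite (states S)"
    "q \<in> states S" "sat S q \<phi>"
    unfolding finitely_satisfiable_def by auto
  moreover from this have "sat S q (Exists p \<phi>)"
    using agree_except_refl[of S p] by auto
  ultimately show "finitely_satisfiable (Exists p \<phi>)" by (intro finitely_satisfiableI)
qed

theorem theorem5p2:
  "(\<forall>k\<ge>1. \<not> decidable_problem qctl_code {\<phi>. AQCTL k \<phi>} finitely_satisfiable) \<and>
   (\<forall>k\<ge>2. \<not> decidable_problem qctl_code {\<phi>. EQCTL k \<phi>} finitely_satisfiable)"
proof (intro conjI allI impI)
  fix k :: nat assume k: "k \<ge> 1"
  show "\<not> decidable_problem qctl_code {\<phi>. AQCTL k \<phi>} finitely_satisfiable"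
    using coded_alternate[of k]
  proof (rule undecidable_if_coded)
    fix \<phi> assume \<phi>: "CTL \<phi>" "1 \<notin> props \<phi>"
    then show "alternate k \<phi> \<in> {\<phi>. AQCTL k \<phi>} \<and>
        (finitely_satisfiable (alternate k \<phi>) \<longleftrightarrow> finitely_satisfiable (Forall 0 \<phi>))"
      using AQCTL_alternate finitely_satisfiable_alternate k by blast
  qed
next
  fix k :: nat assume k: "k \<ge> 2"
  \<comment> \<open>An outer existential quantifier lifts \<open>AQCTL i\<close> to
    \<open>EQCTL (i + 1)\<close>; \<open>k \<ge> 2\<close> leaves room for the universal level below
    it.\<close>
  define i where "i = k - 1"
  have i: "k = i + 1" "i \<ge> 1" using k by (simp_all add: i_def)
  have "coded (\<lambda>\<phi>. Exists 0 (alternate i \<phi>))"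
    by (rule coded_Exists[OF coded_alternate])
  then show "\<not> decidable_problem qctl_code {\<phi>. EQCTL k \<phi>} finitely_satisfiable"
  proof (rule undecidable_if_coded)
    fix \<phi> assume \<phi>: "CTL \<phi>" "1 \<notin> props \<phi>"
    have "EQCTL k (Exists 0 (alternate i \<phi>))"
      unfolding i(1) by (intro EQCTL_AQCTL.intros AQCTL_alternate \<phi> i)
    then show "Exists 0 (alternate i \<phi>) \<in> {\<phi>. EQCTL k \<phi>} \<and>
        (finitely_satisfiable (Exists 0 (alternate i \<phi>)) \<longleftrightarrow> finitely_satisfiable (Forall 0 \<phi>))"
      using finitely_satisfiable_Exists finitely_satisfiable_alternate[OF \<phi> i(2)] by blast
  qed
qed

end
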